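(* Let $\beta\in\mathbb{R}\setminus\{0\}$ and $\psi(x)=x+\beta$ for $x\in\mathbb{R}$. Then the composition operator $C_\psi:\mathcal{O}_M(\mathbb{R})\to\mathcal{O}_M(\mathbb{R})$, $f\mapsto f\circ\psi$, is sequentially hypercyclic on $\mathcal{O}_M(\mathbb{R})$. Additionally, $C_\psi$ is chaotic.
   Context: $\mathbb{N}=\{1,2,3,\ldots\}$, $\mathbb{N}_0=\mathbb{N}\cup\{0\}$. $\mathcal{S}(\mathbb{R})$ is the Schwartz space of rapidly decreasing smooth functions. For $m,n\in\mathbb{N}$ let $\mathcal{O}_n^m(\mathbb{R})=\{f\in C^m(\mathbb{R}): |f|_{m,n}:=\sup_{x\in\mathbb{R},\,0\le j\le m}(1+|x|^2)^{-n}|f^{(j)}(x)|<\infty\}$, a Banach space under $|\cdot|_{m,n}$, and $\mathcal{O}_M(\mathbb{R})=\bigcap_{m=1}^\infty\bigcup_{n=1}^\infty\mathcal{O}_n^m(\mathbb{R})$ (slowly increasing smooth functions, the multipliers of $\mathcal{S}(\mathbb{R})$). It carries the locally convex topology of the projective limit over $m$ of the (LB)-spaces $\operatorname{ind}_{n\to\infty}\mathcal{O}_n^m(\mathbb{R})$; equivalently, the topology given by the seminorms $p_{m,v}(f)=\sup_{x\in\mathbb{R}}\max_{0\le j\le m}|v(x)f^{(j)}(x)|$, $m\ge 0$, $v\in\mathcal{S}(\mathbb{R})$. Let $T$ be a continuous linear operator on a topological vector space $E$. $T$ is sequentially hypercyclic if there is $x\in E$ whose orbit $\{T^nx: n\in\mathbb{N}_0\}$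 is sequentially dense in $E$, i.e. every element of $E$ is the limit of a sequence of elements of the orbit. $T$ is topologically transitive if for every pair of non-empty open sets $U,V\subseteq E$ one has $T^n(U)\cap V\neq\emptyset$ for some $n\in\mathbb{N}$; $T$ is chaotic if it is topologically transitive and its set of periodic points is dense in $E$. *)

theory Defs
  imports "HOL-Analysis.Analysis"
begin

primrec nth_deriv :: "nat \<Rightarrow> (real \<Rightarrow> complex) \<Rightarrow> real \<Rightarrow> complex" where
  "nth_deriv 0 f = f"
| "nth_deriv (Suc j) f = (\<lambda>x. vector_derivative (nth_deriv j f) (at x))"

definition C_times :: "nat \<Rightarrow> (real \<Rightarrow> complex) set" where
  "C_times m = {f. (\<forall>j<m. \<forall>x. nth_deriv j f differentiable (at x)) \<and>
                   continuous_on UNIV (nth_deriv m f)}"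

definition schwartz_space :: "(real \<Rightarrow> complex) set" where
  "schwartz_space = {v \<in> (\<Inter>m. C_times m).
     \<forall>k j. bdd_above (range (\<lambda>x. \<bar>x\<bar> ^ k * norm (nth_deriv j v x)))}"

definition O_space :: "nat \<Rightarrow> nat \<Rightarrow> (real \<Rightarrow> complex) set" where
  "O_space m n = {f \<in> C_times m.
     bdd_above ((\<lambda>(x, j). norm (nth_deriv j f x) / (1 + \<bar>x\<bar>\<^sup>2) ^ n) ` (UNIV \<times> {0..m}))}"

definition O_M :: "(real \<Rightarrow> complex) set" where
  "O_M = (\<Inter>m\<in>{1..}. \<Union>n\<in>{1..}. O_space m n)"

text \<open>For \<open>v\<close> in the Schwartz space and \<open>f\<close> in \<open>O_M\<close> the set below is bounded above, so the
  supremum, taken in the reals, is a genuine one.\<close>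

definition OM_seminorm :: "nat \<Rightarrow> (real \<Rightarrow> complex) \<Rightarrow> (real \<Rightarrow> complex) \<Rightarrow> real" where
  "OM_seminorm m v f = (SUP (x, j) \<in> UNIV \<times> {0..m}. norm (v x * nth_deriv j f x))"

text \<open>The open seminorm balls with arbitrary centres form a subbasis of the locally convex
  topology defined by the seminorms.\<close>

definition OM_topology :: "(real \<Rightarrow> complex) topology" where
  "OM_topology = topology_generated_by
     {{g \<in> O_M. OM_seminorm m v (\<lambda>x. g x - f x) < e} | m v f e.
        v \<in> schwartz_space \<and> f \<in> O_M \<and> e > 0}"

lemma nth_deriv_zero [simp]: "nth_deriv j (\<lambda>x. 0) = (\<lambda>x. 0)"
  by (induction j) auto

lemma zero_in_schwartz_space: "(\<lambda>x. 0) \<in> schwartz_space"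
  by (auto simp: schwartz_space_def C_times_def bdd_above_def)

lemma OM_seminorm_zero [simp]: "OM_seminorm m v (\<lambda>x. 0) = 0"
proof -
  have "(\<lambda>(x, j). norm (v x * nth_deriv j (\<lambda>x. 0) x)) ` (UNIV \<times> {0..m}) = {0}"
    by (auto intro!: image_eqI[where x = "(0, 0)"])
  then show ?thesis
    unfolding OM_seminorm_def by simp
qed

lemma topspace_OM_topology [simp]: "topspace OM_topology = O_M"
  unfolding OM_topology_def topology_generated_by_topspace
proof (intro equalityI subsetI)
  fix f assume f: "f \<in> O_M"
  let ?B = "{g \<in> O_M. OM_seminorm 0 (\<lambda>x. 0) (\<lambda>x. g x - f x) < 1}"
  have "f \<in> ?B"
    using f by simp
  moreover have "?B \<in> {{g \<in> O_M. OM_seminorm m v (\<lambda>x. g x - f x) < e} | m v f e.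
        v \<in> schwartz_space \<and> f \<in> O_M \<and> e > 0}"
    using f zero_in_schwartz_space zero_less_one by blast
  ultimately show "f \<in> \<Union> {{g \<in> O_M. OM_seminorm m v (\<lambda>x. g x - f x) < e} | m v f e.
        v \<in> schwartz_space \<and> f \<in> O_M \<and> e > 0}"
    by (rule UnionI[rotated])
qed auto

definition continuous_linear_operator ::
    "(real \<Rightarrow> complex) topology \<Rightarrow> ((real \<Rightarrow> complex) \<Rightarrow> (real \<Rightarrow> complex)) \<Rightarrow> bool" where
  "continuous_linear_operator E T \<longleftrightarrow>
     continuous_map E E T \<and>
     (\<forall>f\<in>topspace E. \<forall>g\<in>topspace E. \<forall>a b.
        T (\<lambda>x. a * f x + b * g x) = (\<lambda>x. a * T f x + b * T g x))"

definition sequentially_hypercyclic :: "'a topology \<Rightarrow> ('a \<Rightarrow> 'a) \<Rightarrow> bool" where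
  "sequentially_hypercyclic E T \<longleftrightarrow>
     (\<exists>x\<in>topspace E. \<forall>y\<in>topspace E.
        \<exists>s. range s \<subseteq> {(T ^^ n) x | n. True} \<and> limitin E s y sequentially)"

definition topologically_transitive :: "'a topology \<Rightarrow> ('a \<Rightarrow> 'a) \<Rightarrow> bool" where
  "topologically_transitive E T \<longleftrightarrow>
     (\<forall>U V. openin E U \<and> openin E V \<and> U \<noteq> {} \<and> V \<noteq> {} \<longrightarrow>
        (\<exists>n\<ge>1. (T ^^ n) ` U \<inter> V \<noteq> {}))"

definition periodic_points :: "'a topology \<Rightarrow> ('a \<Rightarrow> 'a) \<Rightarrow> 'a set" where
  "periodic_points E T = {x \<in> topspace E. \<exists>n\<ge>1. (T ^^ n) x = x}"

definition chaotic :: "'a topology \<Rightarrow> ('a \<Rightarrow> 'a) \<Rightarrow> bool" where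
  "chaotic E T \<longleftrightarrow>
     topologically_transitive E T \<and> E closure_of periodic_points E T = topspace E"

definition composition_operator ::
    "(real \<Rightarrow> real) \<Rightarrow> (real \<Rightarrow> complex) \<Rightarrow> (real \<Rightarrow> complex)" where
  "composition_operator \<psi> f = f \<circ> \<psi>"

end

theory Submission
  imports Defs
begin

text \<open>Smooth functions of compact support contain a countable family \<open>(h\<^sub>i)\<close> such that every function in
  \<open>O_M\<close> is the limit of a sequence from the family, convergence being uniform in every derivative up
  to a polynomial weight. Placing translates of the \<open>h\<^sub>i\<close>, each infinitely often, on disjoint intervals
  whose centres are rapidly growing multiples of \<open>\<beta>\<close> yields a function in \<open>O_M\<close> whose translates back to
  these centres approximate every \<open>h\<^sub>i\<close>, hence everything: the remaining bumps are far away and, relative to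
  their distance, of at most linear size. These approximations occur at arbitrarily late times, which
  also gives transitivity. Placing copies of a single \<open>h\<^sub>i\<close> with a large period gives
  periodic functions converging to \<open>h\<^sub>i\<close>.\<close>

section \<open>Smooth functions\<close>

text \<open>The topology has a seminorm for every Schwartz weight, and no countable subfamily
  determines it. So Baire category is not at hand, and sequences cannot be selected seminorm by
  seminorm. Convergence is therefore controlled by the stronger relation
  \<open>strongly_close\<close>: for every derivative order one fixed polynomial weight, against
  which the errors tend to 0 uniformly. These are countably many conditions, and since a Schwartz
  function beats every polynomial, they settle all seminorms at once. The weight is also the source
  of smallness: an error bounded by a multiple of \<open>(1 + x\<^sup>2) ^ n\<close> that lives only
  where \<open>\<bar>x\<bar>\<close> is large becomes small against the next power. This makes
  truncation harmless. In the same way foreign bumps of linear size vanish against the weight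
  \<open>1 + x\<^sup>2\<close> once they are far away, so the bumps need not be bounded as a family,
  and a dense sequence indeed is not.\<close>

definition smooth_fun :: "(real \<Rightarrow> complex) \<Rightarrow> bool" where
  "smooth_fun f \<longleftrightarrow> (\<forall>j x. nth_deriv j f differentiable (at x))"

lemma smooth_fun_has_vector_derivative:
  "smooth_fun f \<Longrightarrow> (nth_deriv j f has_vector_derivative nth_deriv (Suc j) f x) (at x)"
  by (simp add: smooth_fun_def vector_derivative_works)

lemma smooth_fun_continuous_on: "smooth_fun f \<Longrightarrow> continuous_on S (nth_deriv j f)"
  by (meson smooth_fun_def continuous_at_imp_continuous_on differentiable_imp_continuous_within)

text \<open>A guess \<open>F\<close> for all derivatives at once, checked one differentiation at a
  time, gives both the smoothness and the formula. Most closure properties below arise by exhibiting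
  such a family.\<close>

lemma
  assumes "F 0 = f" "\<And>j x. (F j has_vector_derivative F (Suc j) x) (at x)"
  shows nth_deriv_eqI: "nth_deriv j f = F j" and smooth_funI: "smooth_fun f"
proof -
  have eq: "nth_deriv j f = F j" for j
    by (induction j) (use assms in \<open>auto simp: vector_derivative_at\<close>)
  then show "nth_deriv j f = F j" .
  show "smooth_fun f"
    unfolding smooth_fun_def eq using assms(2) differentiableI_vector by blast
qed

lemma smooth_fun_iff_C_times: "smooth_fun f \<longleftrightarrow> (\<forall>m\<ge>1. f \<in> C_times m)"
proof
  show "smooth_fun f \<Longrightarrow> \<forall>m\<ge>1. f \<in> C_times m"
    using smooth_fun_continuous_on by (auto simp: C_times_def smooth_fun_def)
  show "\<forall>m\<ge>1. f \<in> C_times m \<Longrightarrow> smooth_fun f"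
    unfolding smooth_fun_def
  proof (intro allI)
    fix j x assume "\<forall>m\<ge>1. f \<in> C_times m"
    then have "f \<in> C_times (Suc j)" by simp
    then show "nth_deriv j f differentiable (at x)"
      by (simp add: C_times_def)
  qed
qed

text \<open>Holds for arbitrary functions: \<open>vector_derivative\<close> chooses among the
  \<open>D\<close> satisfying \<open>has_vector_derivative\<close>, and on an open set where the
  functions agree this predicate is the same for both, so the chosen values agree even where no
  derivative exists.\<close>

lemma nth_deriv_local:
  assumes "open S" "\<And>y. y \<in> S \<Longrightarrow> f y = g y" "x \<in> S"
  shows "nth_deriv j f x = nth_deriv j g x"
  using assms(3)
proof (induction j arbitrary: x)
  case (Suc j)
  have "(nth_deriv j f has_vector_derivative D) (at x) \<longleftrightarrow>
      (nth_deriv j g has_vector_derivative D) (at x)" for D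
    using Suc assms(1) has_vector_derivative_transform_within_open[of _ D x S] by metis
  then show ?case
    by (simp add: vector_derivative_def)
qed (use assms in auto)

lemma smooth_fun_local:
  assumes "\<And>x. \<exists>S g. open S \<and> x \<in> S \<and> smooth_fun g \<and> (\<forall>y\<in>S. f y = g y)"
  shows "smooth_fun f"
  unfolding smooth_fun_def
proof (intro allI)
  fix j x
  obtain S g where S: "open S" "x \<in> S" "smooth_fun g" "\<And>y. y \<in> S \<Longrightarrow> f y = g y"
    using assms[of x] by auto
  have eq: "nth_deriv j g y = nth_deriv j f y" if "y \<in> S" for y
    by (rule nth_deriv_local[OF S(1) _ that]) (simp add: S(4))
  have "(nth_deriv j f has_vector_derivative nth_deriv (Suc j) g x) (at x)"
    by (rule has_vector_derivative_transform_within_open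
        [OF smooth_fun_has_vector_derivative[OF S(3)] S(1,2) eq])
  then show "nth_deriv j f differentiable (at x)"
    by (rule differentiableI_vector)
qed

section \<open>Closure properties of smooth functions\<close>

lemma nth_deriv_const: "nth_deriv j (\<lambda>x. c) = (\<lambda>x. if j = 0 then c else 0)"
  by (rule nth_deriv_eqI[where F = "\<lambda>j x. if j = 0 then c else 0"]) auto

lemma smooth_fun_const: "smooth_fun (\<lambda>x. c)"
  by (rule smooth_funI[where F = "\<lambda>j x. if j = 0 then c else 0"]) auto

lemma
  assumes "smooth_fun f" "smooth_fun g"
  shows smooth_fun_diff: "smooth_fun (\<lambda>x. f x - g x)"
    and nth_deriv_diff: "nth_deriv j (\<lambda>x. f x - g x) = (\<lambda>x. nth_deriv j f x - nth_deriv j g x)"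
proof -
  have *: "((\<lambda>x. nth_deriv j f x - nth_deriv j g x) has_vector_derivative
      nth_deriv (Suc j) f x - nth_deriv (Suc j) g x) (at x)" for j x
    by (intro has_vector_derivative_diff smooth_fun_has_vector_derivative assms)
  show "smooth_fun (\<lambda>x. f x - g x)"
    "nth_deriv j (\<lambda>x. f x - g x) = (\<lambda>x. nth_deriv j f x - nth_deriv j g x)"
    by (rule smooth_funI[where F = "\<lambda>j x. nth_deriv j f x - nth_deriv j g x", OF _ *]
        nth_deriv_eqI[where F = "\<lambda>j x. nth_deriv j f x - nth_deriv j g x", OF _ *], simp)+
qed

lemma
  assumes "smooth_fun f"
  shows smooth_fun_affine: "smooth_fun (\<lambda>x. f (a * x + b))"
    and nth_deriv_affine: "nth_deriv j (\<lambda>x. f (a * x + b)) = (\<lambda>x. a ^ j *\<^sub>R nth_deriv j f (a * x + b))"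
proof -
  have *: "((\<lambda>x. a ^ j *\<^sub>R nth_deriv j f (a * x + b)) has_vector_derivative
      a ^ Suc j *\<^sub>R nth_deriv (Suc j) f (a * x + b)) (at x)" for j x
  proof -
    have "((\<lambda>x. nth_deriv j f (a * x + b)) has_vector_derivative
        a *\<^sub>R nth_deriv (Suc j) f (a * x + b)) (at x)"
      by (rule vector_diff_chain_at[OF _ smooth_fun_has_vector_derivative[OF assms], unfolded o_def])
        (auto intro!: derivative_eq_intros)
    from bounded_linear.has_vector_derivative[OF bounded_linear_scaleR_right this, of "a ^ j"]
    show ?thesis
      by (simp add: mult.commute)
  qed
  show "smooth_fun (\<lambda>x. f (a * x + b))"
    "nth_deriv j (\<lambda>x. f (a * x + b)) = (\<lambda>x. a ^ j *\<^sub>R nth_deriv j f (a * x + b))"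
    by (rule smooth_funI[where F = "\<lambda>j x. a ^ j *\<^sub>R nth_deriv j f (a * x + b)", OF _ *]
        nth_deriv_eqI[where F = "\<lambda>j x. a ^ j *\<^sub>R nth_deriv j f (a * x + b)", OF _ *], simp)+
qed

lemma smooth_fun_shift: "smooth_fun f \<Longrightarrow> smooth_fun (\<lambda>x. f (x + b))"
  using smooth_fun_affine[of f 1 b] by simp

text \<open>Shifting by \<open>b\<close> and back shows that the same \<open>D\<close> are
  derivatives on both sides, so the chosen values coincide for every \<open>f\<close>. This makes it
  an unconditional rewrite rule, as the seminorm identities require.\<close>

lemma nth_deriv_shift: "nth_deriv j (\<lambda>x. f (x + b)) = (\<lambda>x. nth_deriv j f (x + b))"
proof (induction j)
  case (Suc j)
  have "((\<lambda>x. nth_deriv j f (x + b)) has_vector_derivative D) (at x) \<longleftrightarrow>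
      (nth_deriv j f has_vector_derivative D) (at (x + b))" for D x
  proof
    assume "(nth_deriv j f has_vector_derivative D) (at (x + b))"
    then show "((\<lambda>x. nth_deriv j f (x + b)) has_vector_derivative D) (at x)"
      using vector_diff_chain_at[of "\<lambda>x. x + b" 1 x "nth_deriv j f" D]
      by (simp add: o_def has_vector_derivative_add_const)
  next
    assume *: "((\<lambda>x. nth_deriv j f (x + b)) has_vector_derivative D) (at x)"
    have "((\<lambda>x. nth_deriv j f (x + b)) \<circ> (\<lambda>y. y - b) has_vector_derivative 1 *\<^sub>R D) (at (x + b))"
      by (rule vector_diff_chain_at) (use * in \<open>auto intro!: derivative_eq_intros\<close>)
    then show "(nth_deriv j f has_vector_derivative D) (at (x + b))"
      by (simp add: o_def)
  qed
  then show ?case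
    by (simp add: Suc vector_derivative_def)
qed auto

text \<open>\<open>leib f g j a b\<close> is the \<open>j\<close>-th derivative of the product of the \<open>a\<close>-th derivative of
  \<open>f\<close> and the \<open>b\<close>-th derivative of \<open>g\<close>, with the binomial coefficients
  of the Leibniz formula left unevaluated.\<close>

primrec leib :: "(real \<Rightarrow> complex) \<Rightarrow> (real \<Rightarrow> complex) \<Rightarrow> nat \<Rightarrow> nat \<Rightarrow> nat \<Rightarrow> real \<Rightarrow> complex" where
  "leib f g 0 a b = (\<lambda>x. nth_deriv a f x * nth_deriv b g x)"
| "leib f g (Suc j) a b = (\<lambda>x. leib f g j (Suc a) b x + leib f g j a (Suc b) x)"

lemma leib_has_vector_derivative:
  assumes "smooth_fun f" "smooth_fun g"
  shows "(leib f g j a b has_vector_derivative leib f g (Suc j) a b x) (at x)"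
proof (induction j arbitrary: a b)
  case 0
  show ?case
    using has_vector_derivative_mult[OF smooth_fun_has_vector_derivative[OF assms(1), of a x]
        smooth_fun_has_vector_derivative[OF assms(2), of b x]]
    by (simp add: add.commute)
next
  case (Suc j)
  from has_vector_derivative_add[OF Suc[of "Suc a" b] Suc[of a "Suc b"]] show ?case
    by simp
qed

text \<open>Each step of the recursion doubles the number of products, which gives the factor
  \<open>2 ^ j\<close>; this is the sum of the binomial coefficients.\<close>

lemma norm_leib_le:
  assumes "\<And>i. i \<le> a + j \<Longrightarrow> norm (nth_deriv i f x) \<le> A" "\<And>i. i \<le> b + j \<Longrightarrow> norm (nth_deriv i g x) \<le> B"
  shows "norm (leib f g j a b x) \<le> 2 ^ j * (A * B)"
  using assms
proof (induction j arbitrary: a b)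
  case 0
  from 0[of a] 0(2)[of b] show ?case
    by (simp add: norm_mult mult_mono')
next
  case (Suc j)
  have "norm (leib f g j (Suc a) b x) \<le> 2 ^ j * (A * B)" "norm (leib f g j a (Suc b) x) \<le> 2 ^ j * (A * B)"
    by (rule Suc.IH; rule Suc.prems; simp)+
  then show ?case
    using norm_triangle_ineq[of "leib f g j (Suc a) b x" "leib f g j a (Suc b) x"] by simp
qed

lemma
  assumes "smooth_fun f" "smooth_fun g"
  shows smooth_fun_mult: "smooth_fun (\<lambda>x. f x * g x)"
    and nth_deriv_mult: "nth_deriv j (\<lambda>x. f x * g x) = leib f g j 0 0"
proof -
  note * = leib_has_vector_derivative[OF assms, of _ 0 0]
  show "smooth_fun (\<lambda>x. f x * g x)" "nth_deriv j (\<lambda>x. f x * g x) = leib f g j 0 0"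
    by (rule smooth_funI[where F = "\<lambda>j. leib f g j 0 0", OF _ *]
        nth_deriv_eqI[where F = "\<lambda>j. leib f g j 0 0", OF _ *], simp)+
qed

lemma norm_nth_deriv_mult_le:
  assumes "smooth_fun f" "smooth_fun g"
    and "\<And>i. i \<le> j \<Longrightarrow> norm (nth_deriv i f x) \<le> A" "\<And>i. i \<le> j \<Longrightarrow> norm (nth_deriv i g x) \<le> B"
  shows "norm (nth_deriv j (\<lambda>x. f x * g x) x) \<le> 2 ^ j * (A * B)"
  unfolding nth_deriv_mult[OF assms(1,2)] by (rule norm_leib_le) (use assms(3,4) in auto)

lemma smooth_fun_antiderivative:
  assumes "smooth_fun f" "\<And>x. (F has_vector_derivative f x) (at x)"
  shows "smooth_fun F"
proof (rule smooth_funI[where F = "case_nat F (\<lambda>j. nth_deriv j f)"])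
  show "(case_nat F (\<lambda>j. nth_deriv j f) j has_vector_derivative
      case_nat F (\<lambda>j. nth_deriv j f) (Suc j) x) (at x)" for j x
    using assms(2) smooth_fun_has_vector_derivative[OF assms(1)]
    by (cases j) (auto simp del: nth_deriv.simps(2))
qed simp

section \<open>Cutoff functions\<close>

text \<open>The classical function exp(-1/x), flat at 0, with a polynomial in 1/x as a factor. The
  factor makes the family closed under differentiation, so a single computation covers all
  orders.\<close>

definition flat_fun :: "real poly \<Rightarrow> real \<Rightarrow> real" where
  "flat_fun p x = (if x > 0 then poly p (1 / x) * exp (- (1 / x)) else 0)"

lemma tendsto_poly_times_exp_neg: "((\<lambda>y::real. poly p y * exp (- y)) \<longlongrightarrow> 0) at_top"
proof -
  have "((\<lambda>y::real. \<Sum>i\<le>degree p. coeff p i * (y ^ i / exp y)) \<longlongrightarrow> (\<Sum>i\<le>degree p. coeff p i * 0)) at_top"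
    by (intro tendsto_intros tendsto_power_div_exp_0)
  then show ?thesis
    by (simp add: poly_altdef exp_minus divide_inverse sum_distrib_right mult.assoc)
qed

text \<open>With t = 1/x one has dt/dx = -t^2, so p(t) exp(-t) has the derivative t^2 (p(t) - p'(t))
  exp(-t); \<open>[:0, 0, 1:]\<close> is the polynomial t^2.\<close>

lemma flat_fun_deriv:
  "(flat_fun p has_field_derivative flat_fun ([:0, 0, 1:] * (p - pderiv p)) x) (at x)"
proof -
  consider "x < 0" | "x = 0" | "x > 0" by linarith
  then show ?thesis
  proof cases
    case 1
    have "((\<lambda>x. 0) has_field_derivative 0) (at x)" by simp
    then have "(flat_fun p has_field_derivative 0) (at x)"
      by (rule has_field_derivative_transform_within_open[where S = "{..<0}"])
        (use 1 in \<open>auto simp: flat_fun_def\<close>)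
    with 1 show ?thesis by (simp add: flat_fun_def)
  next
    case 3
    have "((\<lambda>x. poly p (1 / x) * exp (- (1 / x))) has_field_derivative
        poly ([:0, 0, 1:] * (p - pderiv p)) (1 / x) * exp (- (1 / x))) (at x)"
      using 3 by (auto intro!: derivative_eq_intros DERIV_chain'[OF _ poly_DERIV]
          simp: field_simps power2_eq_square)
    then have "(flat_fun p has_field_derivative
        poly ([:0, 0, 1:] * (p - pderiv p)) (1 / x) * exp (- (1 / x))) (at x)"
      by (rule has_field_derivative_transform_within_open[where S = "{0<..}"])
        (use 3 in \<open>auto simp: flat_fun_def\<close>)
    with 3 show ?thesis by (simp add: flat_fun_def)
  next
    case 2
    have "((\<lambda>h. flat_fun p h / h) \<longlongrightarrow> 0) (at 0)"
    proof (rule filterlim_split_at)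
      show "((\<lambda>h. flat_fun p h / h) \<longlongrightarrow> 0) (at_left 0)"
        by (rule tendsto_eventually) (auto simp: eventually_at_filter flat_fun_def)
      \<comment> \<open>Dividing by \<open>h\<close> multiplies the polynomial by its variable, so
        the difference quotient at 0 is again a polynomial in 1/h against an exponential.\<close>
      have "((\<lambda>h. poly (pCons 0 p) (inverse h) * exp (- inverse h)) \<longlongrightarrow> 0) (at_right 0)"
        by (rule filterlim_compose[OF tendsto_poly_times_exp_neg filterlim_inverse_at_top_right])
      then show "((\<lambda>h. flat_fun p h / h) \<longlongrightarrow> 0) (at_right 0)"
        by (rule Lim_transform_eventually)
          (auto simp: eventually_at_filter flat_fun_def field_simps)
    qed
    with 2 show ?thesis
      by (simp add: DERIV_def flat_fun_def)
  qed
qed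

lemma smooth_fun_flat: "smooth_fun (\<lambda>x. complex_of_real (flat_fun p x))"
proof (rule smooth_funI)
  let ?q = "\<lambda>j. ((\<lambda>p. [:0, 0, 1:] * (p - pderiv p)) ^^ j) p"
  show "(\<lambda>x. complex_of_real (flat_fun (?q 0) x)) = (\<lambda>x. complex_of_real (flat_fun p x))"
    by simp
  show "((\<lambda>x. complex_of_real (flat_fun (?q j) x)) has_vector_derivative
      complex_of_real (flat_fun (?q (Suc j)) x)) (at x)" for j x
    using flat_fun_deriv[of "?q j" x]
    by (auto intro!: has_vector_derivative_of_real simp: has_real_derivative_iff_has_vector_derivative)
qed

lemma smooth_step_exists:
  obtains \<phi> where "smooth_fun \<phi>" "\<And>x. x \<le> 0 \<Longrightarrow> \<phi> x = 0" "\<And>x. x \<ge> 1 \<Longrightarrow> \<phi> x = 1"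
proof -
  define w where "w x = flat_fun 1 x * flat_fun 1 (1 - x)" for x
  have w_smooth: "smooth_fun (\<lambda>x. complex_of_real (w x))"
    using smooth_fun_mult[OF smooth_fun_flat[of 1] smooth_fun_affine[OF smooth_fun_flat[of 1], of "-1" 1]]
    by (simp add: w_def)
  have w0: "w x = 0" if "x \<le> 0 \<or> x \<ge> 1" for x
    using that by (auto simp: w_def flat_fun_def)
  have w_pos: "w x > 0" if "0 < x" "x < 1" for x
    using that by (auto simp: w_def flat_fun_def)
  have "continuous_on UNIV (\<lambda>x. Re (complex_of_real (w x)))"
    using smooth_fun_continuous_on[OF w_smooth, of UNIV 0] by (intro continuous_intros) simp
  then have w_cont: "continuous_on S w" for S
    by (auto intro: continuous_on_subset)
  \<comment> \<open>The bump \<open>w\<close> vanishes left of 0, so the lower limit -1 does not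
    alter the integral from 0 on, but makes \<open>x = 0\<close> an interior point for the
    fundamental theorem.\<close>
  define \<phi> where "\<phi> x = integral {-1..x} w" for x
  have \<phi>0: "\<phi> x = 0" if "x \<le> 0" for x
    unfolding \<phi>_def using that w0 by (intro integral_eq_0_iff[THEN iffD2] integral_unique has_integral_is_0) auto
  have deriv: "(\<phi> has_field_derivative w x) (at x)" for x
  proof (cases "x < 0")
    case True
    have "((\<lambda>x. 0) has_field_derivative 0) (at x)" by simp
    then have "(\<phi> has_field_derivative 0) (at x)"
      by (rule has_field_derivative_transform_within_open[where S = "{..<0}"])
        (use True \<phi>0 in auto)
    with True w0 show ?thesis by simp
  next
    case False
    have "(\<phi> has_vector_derivative w x) (at x within {-1..x+1})"
      unfolding \<phi>_def by (rule integral_has_vector_derivative[OF w_cont]) (use False in auto)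
    then have "(\<phi> has_vector_derivative w x) (at x)"
      using at_within_interior[of x "{-1..x+1}"] False by auto
    then show ?thesis
      by (simp add: has_real_derivative_iff_has_vector_derivative)
  qed
  have "\<phi> 0 < \<phi> 1"
  proof (rule DERIV_pos_imp_increasing_open[of 0 1 \<phi>])
    show "\<exists>y. (\<phi> has_real_derivative y) (at x) \<and> y > 0" if "0 < x" "x < 1" for x
      using deriv w_pos that by blast
    show "continuous_on {0..1} \<phi>"
      using deriv by (meson DERIV_isCont continuous_at_imp_continuous_on)
  qed simp
  then have \<phi>1: "\<phi> 1 > 0"
    using \<phi>0 by simp
  have \<phi>_const: "\<phi> x = \<phi> 1" if "x \<ge> 1" for x
  proof -
    have "\<exists>c. \<forall>x\<in>{1..}. \<phi> x = c"
    proof (rule has_field_derivative_zero_constant)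
      show "(\<phi> has_field_derivative 0) (at x within {1..})" if "x \<in> {1..}" for x
        using deriv[of x] w0[of x] that by (auto intro: has_field_derivative_at_within)
    qed simp
    then show ?thesis using that by fastforce
  qed
  show thesis
  proof
    have "smooth_fun (\<lambda>x. complex_of_real (\<phi> x))"
      by (rule smooth_fun_antiderivative[OF w_smooth])
        (use deriv in \<open>auto intro!: has_vector_derivative_of_real simp: has_real_derivative_iff_has_vector_derivative\<close>)
    from smooth_fun_mult[OF smooth_fun_const[of "1 / complex_of_real (\<phi> 1)"] this]
    show "smooth_fun (\<lambda>x. complex_of_real (\<phi> x / \<phi> 1))" by simp
    show "complex_of_real (\<phi> x / \<phi> 1) = 1" if "x \<ge> 1" for x
      using \<phi>1 by (simp add: \<phi>_const[OF that])
  qed (simp add: \<phi>0)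
qed

section \<open>The space and its topology\<close>

lemma O_M_uniform_bound:
  assumes "f \<in> O_M"
  shows "\<exists>n C. \<forall>i\<le>j. \<forall>x. norm (nth_deriv i f x) \<le> C * (1 + x\<^sup>2) ^ n"
proof -
  \<comment> \<open>\<open>Suc j\<close> because the intersection defining \<open>O_M\<close> starts
    at order 1.\<close>
  obtain n where "f \<in> O_space (Suc j) n"
    using assms by (fastforce simp: O_M_def)
  then obtain C where
    C: "norm (nth_deriv i f x) / (1 + \<bar>x\<bar>\<^sup>2) ^ n \<le> C" if "i \<le> Suc j" for i x
    unfolding O_space_def bdd_above_def by fastforce
  have "norm (nth_deriv i f x) \<le> C * (1 + x\<^sup>2) ^ n" if "i \<le> j" for i x
  proof -
    have "(1 + x\<^sup>2) ^ n > 0"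
      by (intro zero_less_power add_pos_nonneg) auto
    then show ?thesis
      using C[of i x] that by (simp add: pos_divide_le_eq)
  qed
  then show ?thesis
    by blast
qed

lemma O_M_iff:
  "f \<in> O_M \<longleftrightarrow> smooth_fun f \<and> (\<forall>j. \<exists>n C. \<forall>x. norm (nth_deriv j f x) \<le> C * (1 + x\<^sup>2) ^ n)"
proof (intro iffI conjI allI)
  assume f: "f \<in> O_M"
  then show "smooth_fun f"
    unfolding smooth_fun_iff_C_times by (fastforce simp: O_M_def O_space_def)
  show "\<exists>n C. \<forall>x. norm (nth_deriv j f x) \<le> C * (1 + x\<^sup>2) ^ n" for j
    using O_M_uniform_bound[OF f, of j] by blast
next
  assume *: "smooth_fun f \<and> (\<forall>j. \<exists>n C. \<forall>x. norm (nth_deriv j f x) \<le> C * (1 + x\<^sup>2) ^ n)"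
  then obtain n C where nC: "\<And>j x. norm (nth_deriv j f x) \<le> C j * (1 + x\<^sup>2) ^ n j"
    by metis
  have "\<exists>n\<ge>1. f \<in> O_space m n" if "m \<ge> 1" for m
  proof (intro exI conjI)
    \<comment> \<open>The sum dominates each of the finitely many exponents involved; the leading 1
      guarantees \<open>N \<ge> 1\<close>, as the union in \<open>O_M\<close> demands.\<close>
    define N where "N = 1 + (\<Sum>j\<le>m. n j)"
    have "norm (nth_deriv j f x) / (1 + \<bar>x\<bar>\<^sup>2) ^ N \<le> (\<Sum>j\<le>m. \<bar>C j\<bar>)" if "j \<le> m" for j x
    proof -
      have "n j \<le> N"
        using that member_le_sum[of j "{..m}" n] by (simp add: N_def)
      have "C j * (1 + x\<^sup>2) ^ n j \<le> (\<Sum>j\<le>m. \<bar>C j\<bar>) * (1 + x\<^sup>2) ^ N"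
      proof (rule mult_mono)
        show "C j \<le> (\<Sum>j\<le>m. \<bar>C j\<bar>)"
          using that member_le_sum[of j "{..m}" "\<lambda>j. \<bar>C j\<bar>"] by simp
        show "(1 + x\<^sup>2) ^ n j \<le> (1 + x\<^sup>2) ^ N"
          using \<open>n j \<le> N\<close> by (intro power_increasing) auto
      qed (auto intro!: sum_nonneg)
      moreover have "(1 + x\<^sup>2) ^ N > 0"
        by (intro zero_less_power add_pos_nonneg) auto
      ultimately show ?thesis
        using nC[of j x] by (simp add: pos_divide_le_eq)
    qed
    moreover have "f \<in> C_times m"
      using * that by (auto simp: smooth_fun_iff_C_times)
    ultimately show "f \<in> O_space m N"
      unfolding O_space_def by (auto intro!: bdd_aboveI2)
    show "N \<ge> 1"
      by (simp add: N_def)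
  qed
  then show "f \<in> O_M"
    by (auto simp: O_M_def)
qed

lemma O_M_shift:
  assumes "f \<in> O_M"
  shows "(\<lambda>x. f (x + b)) \<in> O_M"
  unfolding O_M_iff
proof (intro conjI allI)
  show "smooth_fun (\<lambda>x. f (x + b))"
    using assms by (simp add: O_M_iff smooth_fun_shift)
  fix j
  obtain n C where C: "\<And>x. norm (nth_deriv j f x) \<le> C * (1 + x\<^sup>2) ^ n"
    using assms unfolding O_M_iff by metis
  have "C \<ge> 0"
    using order_trans[OF norm_ge_zero C[of 0]] by simp
  have "norm (nth_deriv j f (x + b)) \<le> (C * (2 * (1 + b\<^sup>2)) ^ n) * (1 + x\<^sup>2) ^ n" for x
  proof -
    \<comment> \<open>A form of Peetre's inequality: the difference of the two sides is visibly a
      sum of squares.\<close>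
    have "2 * (1 + b\<^sup>2) * (1 + x\<^sup>2) - (1 + (x + b)\<^sup>2) = 1 + (x - b)\<^sup>2 + 2 * (b * x)\<^sup>2"
      by (simp add: power2_eq_square algebra_simps)
    also have "\<dots> \<ge> 0"
      by simp
    finally have "1 + (x + b)\<^sup>2 \<le> 2 * (1 + b\<^sup>2) * (1 + x\<^sup>2)"
      by simp
    then have "(1 + (x + b)\<^sup>2) ^ n \<le> (2 * (1 + b\<^sup>2) * (1 + x\<^sup>2)) ^ n"
      by (intro power_mono) auto
    then have "C * (1 + (x + b)\<^sup>2) ^ n \<le> C * (2 * (1 + b\<^sup>2) * (1 + x\<^sup>2)) ^ n"
      using \<open>C \<ge> 0\<close> by (rule mult_left_mono)
    with C[of "x + b"] show ?thesis
      by (simp add: power_mult_distrib mult.assoc)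
  qed
  then show "\<exists>n C. \<forall>x. norm (nth_deriv j (\<lambda>x. f (x + b)) x) \<le> C * (1 + x\<^sup>2) ^ n"
    unfolding nth_deriv_shift by blast
qed

lemma O_M_diff:
  assumes "f \<in> O_M" "g \<in> O_M"
  shows "(\<lambda>x. f x - g x) \<in> O_M"
  unfolding O_M_iff
proof (intro conjI allI)
  have sm: "smooth_fun f" "smooth_fun g"
    using assms by (auto simp: O_M_iff)
  then show "smooth_fun (\<lambda>x. f x - g x)"
    by (rule smooth_fun_diff)
  fix j
  obtain n C where C: "\<And>x. norm (nth_deriv j f x) \<le> C * (1 + x\<^sup>2) ^ n"
    using assms unfolding O_M_iff by metis
  obtain n' C' where C': "\<And>x. norm (nth_deriv j g x) \<le> C' * (1 + x\<^sup>2) ^ n'"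
    using assms unfolding O_M_iff by metis
  have pos: "C \<ge> 0" "C' \<ge> 0"
    using order_trans[OF norm_ge_zero C[of 0]] order_trans[OF norm_ge_zero C'[of 0]] by simp_all
  have "norm (nth_deriv j f x - nth_deriv j g x) \<le> (C + C') * (1 + x\<^sup>2) ^ (n + n')" for x
  proof -
    have "C * (1 + x\<^sup>2) ^ n \<le> C * (1 + x\<^sup>2) ^ (n + n')" "C' * (1 + x\<^sup>2) ^ n' \<le> C' * (1 + x\<^sup>2) ^ (n + n')"
      using pos by (auto intro!: mult_left_mono power_increasing)
    then show ?thesis
      using norm_triangle_ineq4[of "nth_deriv j f x" "nth_deriv j g x"] C[of x] C'[of x]
      by (simp add: distrib_right)
  qed
  then show "\<exists>n C. \<forall>x. norm (nth_deriv j (\<lambda>x. f x - g x) x) \<le> C * (1 + x\<^sup>2) ^ n"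
    unfolding nth_deriv_diff[OF sm] by blast
qed

section \<open>Schwartz weights, seminorms and the topology\<close>

lemma power_add_le: "(a + b) ^ k \<le> 2 ^ k * (a ^ k + b ^ k)" if "a \<ge> 0" "b \<ge> 0" for a b :: real
proof -
  have "(a + b) ^ k \<le> (2 * max a b) ^ k"
    using that by (intro power_mono) auto
  also have "\<dots> \<le> 2 ^ k * (a ^ k + b ^ k)"
    using that by (auto simp: power_mult_distrib max_def)
  finally show ?thesis .
qed

lemma schwartz_space_decay:
  assumes "v \<in> schwartz_space"
  obtains C where "C > 0" "\<And>x. norm (v x) * (1 + x\<^sup>2) ^ n \<le> C"
proof -
  have bdd: "bdd_above (range (\<lambda>x. \<bar>x\<bar> ^ k * norm (nth_deriv j v x)))" for k j
    using assms by (auto simp: schwartz_space_def)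
  have "\<exists>B. \<forall>x. \<bar>x\<bar> ^ k * norm (v x) \<le> B" for k
    using bdd[of k 0] unfolding bdd_above_def by auto
  then obtain B where B: "\<And>k x. \<bar>x\<bar> ^ k * norm (v x) \<le> B k"
    by metis
  show thesis
  proof
    \<comment> \<open>The added 1 makes the bound strictly positive; it later serves as a
      divisor.\<close>
    show "norm (v x) * (1 + x\<^sup>2) ^ n \<le> 2 ^ n * (\<bar>B 0\<bar> + \<bar>B (2 * n)\<bar>) + 1" for x
    proof -
      have "norm (v x) * (1 + x\<^sup>2) ^ n \<le> norm (v x) * (2 ^ n * (1 ^ n + (x\<^sup>2) ^ n))"
        by (intro mult_left_mono power_add_le) auto
      also have "\<dots> = 2 ^ n * (\<bar>x\<bar> ^ 0 * norm (v x) + \<bar>x\<bar> ^ (2 * n) * norm (v x))"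
        by (simp only: power_mult power2_abs) (simp add: algebra_simps)
      also have "\<dots> \<le> 2 ^ n * (\<bar>B 0\<bar> + \<bar>B (2 * n)\<bar>)"
        using B[of x 0] B[of x "2 * n"] by (intro mult_left_mono add_mono) auto
      finally show ?thesis by simp
    qed
    show "2 ^ n * (\<bar>B 0\<bar> + \<bar>B (2 * n)\<bar>) + 1 > 0"
      by (intro add_nonneg_pos mult_nonneg_nonneg) auto
  qed
qed

lemma schwartz_space_shift:
  assumes "v \<in> schwartz_space"
  shows "(\<lambda>x. v (x + b)) \<in> schwartz_space"
proof -
  have v: "smooth_fun v" "\<And>k j. bdd_above (range (\<lambda>x. \<bar>x\<bar> ^ k * norm (nth_deriv j v x)))"
    using assms by (auto simp: schwartz_space_def smooth_fun_iff_C_times)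
  have "f \<in> C_times m" if "smooth_fun f" for f m
    using that smooth_fun_continuous_on by (auto simp: C_times_def smooth_fun_def)
  moreover have "bdd_above (range (\<lambda>x. \<bar>x\<bar> ^ k * norm (nth_deriv j v (x + b))))" for k j
  proof -
    obtain B where B: "\<And>x. \<bar>x\<bar> ^ k * norm (nth_deriv j v x) \<le> B"
      using v(2)[of k j] unfolding bdd_above_def by fastforce
    obtain B' where B': "\<And>x. \<bar>x\<bar> ^ 0 * norm (nth_deriv j v x) \<le> B'"
      using v(2)[of 0 j] unfolding bdd_above_def by fastforce
    have "\<bar>x\<bar> ^ k * norm (nth_deriv j v (x + b)) \<le> 2 ^ k * (B + \<bar>b\<bar> ^ k * B')" for x
    proof -
      let ?n = "norm (nth_deriv j v (x + b))"
      have "\<bar>x\<bar> ^ k \<le> (\<bar>x + b\<bar> + \<bar>b\<bar>) ^ k"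
        by (intro power_mono) auto
      also have "\<dots> \<le> 2 ^ k * (\<bar>x + b\<bar> ^ k + \<bar>b\<bar> ^ k)"
        by (intro power_add_le) auto
      finally have "\<bar>x\<bar> ^ k * ?n \<le> 2 ^ k * (\<bar>x + b\<bar> ^ k + \<bar>b\<bar> ^ k) * ?n"
        by (rule mult_right_mono) simp
      also have "\<dots> = 2 ^ k * (\<bar>x + b\<bar> ^ k * ?n + \<bar>b\<bar> ^ k * ?n)"
        by (simp add: algebra_simps)
      also have "\<dots> \<le> 2 ^ k * (B + \<bar>b\<bar> ^ k * B')"
        using B[of "x + b"] B'[of "x + b"] by (intro mult_left_mono add_mono) auto
      finally show ?thesis .
    qed
    then show ?thesis by (auto intro!: bdd_aboveI2)
  qed
  ultimately show ?thesis
    using smooth_fun_shift[OF v(1), of b] by (auto simp: schwartz_space_def nth_deriv_shift)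
qed

lemma bdd_above_OM_seminorm:
  assumes "v \<in> schwartz_space" "f \<in> O_M"
  shows "bdd_above ((\<lambda>(x, j). norm (v x * nth_deriv j f x)) ` (UNIV \<times> {0..m}))"
proof -
  have "\<exists>B. \<forall>x. norm (v x * nth_deriv j f x) \<le> B" for j
  proof -
    obtain n C where C: "\<And>x. norm (nth_deriv j f x) \<le> C * (1 + x\<^sup>2) ^ n"
      using assms unfolding O_M_iff by metis
    obtain D where D: "D > 0" "\<And>x. norm (v x) * (1 + x\<^sup>2) ^ n \<le> D"
      using schwartz_space_decay[OF assms(1)] by metis
    have "C \<ge> 0"
      using order_trans[OF norm_ge_zero C[of 0]] by simp
    have "norm (v x * nth_deriv j f x) \<le> C * D" for x
    proof -
      have "norm (v x * nth_deriv j f x) \<le> norm (v x) * (C * (1 + x\<^sup>2) ^ n)"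
        unfolding norm_mult by (intro mult_left_mono C) auto
      also have "\<dots> = C * (norm (v x) * (1 + x\<^sup>2) ^ n)"
        by simp
      also have "\<dots> \<le> C * D"
        by (intro mult_left_mono D \<open>C \<ge> 0\<close>)
      finally show ?thesis .
    qed
    then show ?thesis by blast
  qed
  then obtain B where B: "\<And>j x. norm (v x * nth_deriv j f x) \<le> B j"
    by metis
  have "norm (v x * nth_deriv j f x) \<le> (\<Sum>j\<le>m. \<bar>B j\<bar>)" if "j \<le> m" for x j
    using that member_le_sum[of j "{..m}" "\<lambda>j. \<bar>B j\<bar>"] B[of x j] by simp
  then show ?thesis
    by (auto intro!: bdd_aboveI2)
qed

lemma OM_seminorm_shift:
  "OM_seminorm m v (\<lambda>x. f (x + b)) = OM_seminorm m (\<lambda>x. v (x - b)) f"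
proof -
  have "(\<lambda>(x, j). (x + b, j)) ` (UNIV \<times> {0..m}) = UNIV \<times> {0..m}"
    by (auto intro!: image_eqI[where x = "(x - b, j)" for x j])
  then have "(SUP (x, j) \<in> UNIV \<times> {0..m}. norm (v (x - b) * nth_deriv j f x)) =
      (SUP (x, j) \<in> (\<lambda>(x, j). (x + b, j)) ` (UNIV \<times> {0..m}). norm (v (x - b) * nth_deriv j f x))"
    by simp
  then show ?thesis
    unfolding OM_seminorm_def nth_deriv_shift by (simp add: image_image case_prod_unfold)
qed

text \<open>The preimage of a subbasic ball is a subbasic ball of the same radius, with weight and
  centre shifted by \<open>- b\<close>; both shifted functions stay in their spaces.\<close>

lemma continuous_map_shift: "continuous_map OM_topology OM_topology (\<lambda>f x. f (x + b))"
  unfolding OM_topology_def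
proof (rule continuous_on_generated_topo, fold OM_topology_def)
  fix U assume "U \<in> {{g \<in> O_M. OM_seminorm m v (\<lambda>x. g x - f x) < e} | m v f e.
        v \<in> schwartz_space \<and> f \<in> O_M \<and> e > 0}"
  then obtain m v f e where U: "U = {g \<in> O_M. OM_seminorm m v (\<lambda>x. g x - f x) < e}"
    and v: "v \<in> schwartz_space" and f: "f \<in> O_M" and e: "e > 0"
    by auto
  have *: "OM_seminorm m v (\<lambda>x. g (x + b) - f x) = OM_seminorm m (\<lambda>x. v (x - b)) (\<lambda>x. g x - f (x - b))" for g
    using OM_seminorm_shift[of m v "\<lambda>x. g x - f (x - b)" b] by simp
  have "(\<lambda>f x. f (x + b)) -` U \<inter> topspace OM_topology =
      {g \<in> O_M. OM_seminorm m (\<lambda>x. v (x - b)) (\<lambda>x. g x - f (x - b)) < e}"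
    by (auto simp: U * O_M_shift)
  moreover have "openin OM_topology \<dots>"
    unfolding OM_topology_def
    by (rule topology_generated_by_Basis, unfold mem_Collect_eq, intro exI conjI, rule refl)
      (use schwartz_space_shift[OF v, of "-b"] O_M_shift[OF f, of "-b"] e in auto)
  ultimately show "openin OM_topology ((\<lambda>f x. f (x + b)) -` U \<inter> topspace OM_topology)"
    by simp
next
  show "(\<lambda>f x. f (x + b)) ` topspace OM_topology \<subseteq> \<Union> {{g \<in> O_M. OM_seminorm m v (\<lambda>x. g x - f x) < e} |m v f e.
       v \<in> schwartz_space \<and> f \<in> O_M \<and> 0 < e}"
    using topspace_OM_topology O_M_shift unfolding OM_topology_def topology_generated_by_topspace by auto
qed

text \<open>The exponent \<open>n\<close> may depend on the order \<open>j\<close> but is fixed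
  before \<open>e\<close>. Comparing two sequences, rather than a sequence with a limit, allows
  chains through moving intermediates such as truncations or the bumps \<open>g k\<close>.\<close>

definition strongly_close ::
    "(nat \<Rightarrow> real \<Rightarrow> complex) \<Rightarrow> (nat \<Rightarrow> real \<Rightarrow> complex) \<Rightarrow> bool" where
  "strongly_close s t \<longleftrightarrow> (\<forall>j. \<exists>n. \<forall>e>0. \<forall>\<^sub>F k in sequentially. \<forall>x.
     norm (nth_deriv j (s k) x - nth_deriv j (t k) x) \<le> e * (1 + x\<^sup>2) ^ n)"

lemma strongly_closeD:
  assumes "strongly_close s t"
  shows "\<exists>n. \<forall>e>0. \<forall>\<^sub>F k in sequentially. \<forall>x.
     norm (nth_deriv j (s k) x - nth_deriv j (t k) x) \<le> e * (1 + x\<^sup>2) ^ n"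
  using assms unfolding strongly_close_def by (rule spec)

lemma strongly_close_trans:
  assumes "strongly_close s t" "strongly_close t u"
  shows "strongly_close s u"
  unfolding strongly_close_def
proof
  fix j
  obtain n where n: "\<forall>e>0. \<forall>\<^sub>F k in sequentially. \<forall>x.
     norm (nth_deriv j (s k) x - nth_deriv j (t k) x) \<le> e * (1 + x\<^sup>2) ^ n"
    using strongly_closeD[OF assms(1), of j] ..
  obtain n' where n': "\<forall>e>0. \<forall>\<^sub>F k in sequentially. \<forall>x.
     norm (nth_deriv j (t k) x - nth_deriv j (u k) x) \<le> e * (1 + x\<^sup>2) ^ n'"
    using strongly_closeD[OF assms(2), of j] ..
  have "\<forall>\<^sub>F k in sequentially. \<forall>x.
     norm (nth_deriv j (s k) x - nth_deriv j (u k) x) \<le> e * (1 + x\<^sup>2) ^ (n + n')" if "e > 0" for e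
    using n[rule_format, OF half_gt_zero[OF that]] n'[rule_format, OF half_gt_zero[OF that]]
  proof eventually_elim
    case (elim k)
    show ?case
    proof
      fix x :: real
      have "e / 2 * (1 + x\<^sup>2) ^ n \<le> e / 2 * (1 + x\<^sup>2) ^ (n + n')"
        "e / 2 * (1 + x\<^sup>2) ^ n' \<le> e / 2 * (1 + x\<^sup>2) ^ (n + n')"
        using that by (intro mult_left_mono power_increasing; simp)+
      moreover have "norm (nth_deriv j (s k) x - nth_deriv j (u k) x) \<le>
          e / 2 * (1 + x\<^sup>2) ^ n + e / 2 * (1 + x\<^sup>2) ^ n'"
        by (rule norm_diff_triangle_le[OF elim(1)[rule_format] elim(2)[rule_format]])
      ultimately show "norm (nth_deriv j (s k) x - nth_deriv j (u k) x) \<le> e * (1 + x\<^sup>2) ^ (n + n')"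
        by linarith
    qed
  qed
  then show "\<exists>n. \<forall>e>0. \<forall>\<^sub>F k in sequentially. \<forall>x.
     norm (nth_deriv j (s k) x - nth_deriv j (u k) x) \<le> e * (1 + x\<^sup>2) ^ n"
    by blast
qed

text \<open>Induction on the generation of the open set leaves only a subbasic ball around some
  \<open>f\<close>. There the decay of \<open>v\<close> absorbs the polynomial weight, and only the
  finitely many orders up to \<open>m\<close> matter.\<close>

lemma strongly_close_imp_limitin:
  assumes s: "\<And>k. s k \<in> O_M" and g: "g \<in> O_M" and close: "strongly_close s (\<lambda>_. g)"
  shows "limitin OM_topology s g sequentially"
  unfolding limitin_def
proof (intro conjI allI impI)
  show "g \<in> topspace OM_topology"
    using g by simp
  fix U assume "openin OM_topology U \<and> g \<in> U"
  then have "generate_topology_on {{g \<in> O_M. OM_seminorm m v (\<lambda>x. g x - f x) < e} | m v f e.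
        v \<in> schwartz_space \<and> f \<in> O_M \<and> e > 0} U" and "g \<in> U"
    by (auto simp: OM_topology_def openin_topology_generated_by_iff)
  then show "\<forall>\<^sub>F k in sequentially. s k \<in> U"
  proof (induction rule: generate_topology_on.induct)
    case (Int a b)
    then show ?case by (auto intro: eventually_conj)
  next
    case (UN K)
    then obtain k where "k \<in> K" "g \<in> k" by blast
    from UN.IH[OF this] have "\<forall>\<^sub>F n in sequentially. s n \<in> k" .
    then show ?case
      by (rule eventually_mono) (use \<open>k \<in> K\<close> in blast)
  next
    case (Basis V)
    then obtain m v f e where V: "V = {g \<in> O_M. OM_seminorm m v (\<lambda>x. g x - f x) < e}"
      and v: "v \<in> schwartz_space" and f: "f \<in> O_M" and e: "e > 0"
      by auto
    \<comment> \<open>Half of the slack of \<open>g\<close> in the ball: pointwise bounds give only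
      a non-strict inequality for the supremum, which must remain strictly below
      \<open>e\<close>.\<close>
    define d where "d = (e - OM_seminorm m v (\<lambda>x. g x - f x)) / 2"
    have d: "d > 0"
      using \<open>g \<in> V\<close> by (simp add: V d_def)
    have ev: "\<forall>\<^sub>F k in sequentially. \<forall>x. norm (v x * (nth_deriv j (s k) x - nth_deriv j g x)) \<le> d" for j
    proof -
      obtain n where n: "\<forall>e>0. \<forall>\<^sub>F k in sequentially. \<forall>x.
          norm (nth_deriv j (s k) x - nth_deriv j g x) \<le> e * (1 + x\<^sup>2) ^ n"
        using strongly_closeD[OF close, of j] ..
      obtain C where C: "C > 0" "\<And>x. norm (v x) * (1 + x\<^sup>2) ^ n \<le> C"
        using schwartz_space_decay[OF v] by metis
      have "\<forall>\<^sub>F k in sequentially. \<forall>x. norm (nth_deriv j (s k) x - nth_deriv j g x) \<le> d / C * (1 + x\<^sup>2) ^ n"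
        using C d by (intro n[rule_format]) auto
      then show ?thesis
      proof eventually_elim
        case (elim k)
        show ?case
        proof
          fix x
          have "norm (v x * (nth_deriv j (s k) x - nth_deriv j g x)) \<le> norm (v x) * (d / C * (1 + x\<^sup>2) ^ n)"
            unfolding norm_mult by (intro mult_left_mono elim[rule_format]) auto
          also have "\<dots> = d / C * (norm (v x) * (1 + x\<^sup>2) ^ n)"
            by simp
          also have "\<dots> \<le> d / C * C"
            using C d by (intro mult_left_mono C) auto
          finally show "norm (v x * (nth_deriv j (s k) x - nth_deriv j g x)) \<le> d"
            using C by simp
        qed
      qed
    qed
    have "\<forall>\<^sub>F k in sequentially. \<forall>j\<in>{0..m}. \<forall>x. norm (v x * (nth_deriv j (s k) x - nth_deriv j g x)) \<le> d"
      using ev by (simp add: eventually_ball_finite)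
    then show ?case
    proof eventually_elim
      case (elim k)
      have sm: "smooth_fun (s k)" "smooth_fun g" "smooth_fun f"
        using s g f by (auto simp: O_M_iff)
      have "OM_seminorm m v (\<lambda>x. s k x - f x) \<le> OM_seminorm m v (\<lambda>x. g x - f x) + d"
        unfolding OM_seminorm_def[of _ _ "\<lambda>x. s k x - f x"]
      proof (rule cSUP_least)
        fix z assume "z \<in> (UNIV :: real set) \<times> {0..m}"
        then obtain x j where z: "z = (x, j)" "j \<in> {0..m}" by auto
        have "norm (v x * nth_deriv j (\<lambda>x. g x - f x) x) \<le> OM_seminorm m v (\<lambda>x. g x - f x)"
          unfolding OM_seminorm_def
          using cSUP_upper[OF _ bdd_above_OM_seminorm[OF v O_M_diff[OF g f]], of "(x, j)" m] z by auto
        moreover have "norm (v x * (nth_deriv j (s k) x - nth_deriv j g x)) \<le> d"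
          using elim z by blast
        moreover have "v x * nth_deriv j (\<lambda>x. s k x - f x) x =
            v x * nth_deriv j (\<lambda>x. g x - f x) x + v x * (nth_deriv j (s k) x - nth_deriv j g x)"
          by (simp add: nth_deriv_diff sm algebra_simps)
        ultimately show "(case z of (x, j) \<Rightarrow> norm (v x * nth_deriv j (\<lambda>x. s k x - f x) x))
            \<le> OM_seminorm m v (\<lambda>x. g x - f x) + d"
          by (auto simp: z intro: norm_triangle_le)
      qed auto
      also have "\<dots> < e"
        using d unfolding d_def by (simp add: field_simps)
      finally show ?case
        using s by (simp add: V)
    qed
  qed auto
qed

section \<open>Countable approximation by compactly supported functions\<close>

lemma smooth_fun_bounded_on_compact:
  assumes "smooth_fun f" "compact S"
  obtains B where "\<And>x. x \<in> S \<Longrightarrow> norm (nth_deriv j f x) \<le> B"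
  using compact_imp_bounded[OF compact_continuous_image[OF smooth_fun_continuous_on[OF assms(1), of S j] assms(2)]]
  by (auto simp: bounded_iff)

text \<open>A fixed step and its mirror image are moved apart and multiplied. Translation and
  reflection preserve the sup norms of the derivatives, so \<open>K\<close> is independent of
  \<open>k\<close>.\<close>

lemma cutoff_exists:
  obtains \<eta> :: "nat \<Rightarrow> real \<Rightarrow> complex" and K :: "nat \<Rightarrow> real"
  where "\<And>k. smooth_fun (\<eta> k)" "\<And>k x. \<bar>x\<bar> \<le> real k \<Longrightarrow> \<eta> k x = 1"
    "\<And>k x. \<bar>x\<bar> \<ge> real k + 1 \<Longrightarrow> \<eta> k x = 0"
    "\<And>k j i x. i \<le> j \<Longrightarrow> norm (nth_deriv i (\<eta> k) x) \<le> K j"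
proof -
  obtain \<phi> where sm: "smooth_fun \<phi>" and \<phi>0: "\<And>x. x \<le> 0 \<Longrightarrow> \<phi> x = 0" and \<phi>1: "\<And>x. x \<ge> 1 \<Longrightarrow> \<phi> x = 1"
    using smooth_step_exists by metis
  have "\<exists>B. \<forall>x. norm (nth_deriv j \<phi> x) \<le> B" for j
  proof -
    obtain B where B: "\<And>x. x \<in> {0..1} \<Longrightarrow> norm (nth_deriv j \<phi> x) \<le> B"
      using smooth_fun_bounded_on_compact[OF sm, of "{0..1}" j] by auto
    \<comment> \<open>Outside the unit interval the step is locally constant with value 0 or 1; the
      1 in the maximum covers order 0 there.\<close>
    have "norm (nth_deriv j \<phi> x) \<le> max B 1" for x
    proof -
      consider "x < 0" | "x \<in> {0..1}" | "x > 1" by fastforce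
      then show ?thesis
      proof cases
        case 1
        then have "nth_deriv j \<phi> x = nth_deriv j (\<lambda>x. 0) x"
          by (intro nth_deriv_local[of "{..<0}"]) (auto simp: \<phi>0)
        then show ?thesis by simp
      next
        case 2
        with B show ?thesis by fastforce
      next
        case 3
        then have "nth_deriv j \<phi> x = nth_deriv j (\<lambda>x. 1) x"
          by (intro nth_deriv_local[of "{1<..}"]) (auto simp: \<phi>1)
        then show ?thesis by (simp add: nth_deriv_const le_max_iff_disj)
      qed
    qed
    then show ?thesis by blast
  qed
  then obtain B where B: "\<And>j x. norm (nth_deriv j \<phi> x) \<le> B j"
    by metis
  define M where "M j = (\<Sum>i\<le>j. B i)" for j
  have B_nonneg: "B i \<ge> 0" for i
    using order_trans[OF norm_ge_zero B[of i 0]] .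
  have M: "norm (nth_deriv i \<phi> x) \<le> M j" if "i \<le> j" for i j x
    using B[of i x] member_le_sum[of i "{..j}" B] that B_nonneg by (simp add: M_def)
  define \<eta> where "\<eta> k x = \<phi> (1 * x + (real k + 1)) * \<phi> (-1 * x + (real k + 1))" for k :: nat and x
  show thesis
  proof
    show "smooth_fun (\<eta> k)" for k
      unfolding \<eta>_def by (intro smooth_fun_mult smooth_fun_affine sm)
    show "\<eta> k x = 1" if "\<bar>x\<bar> \<le> real k" for k x
      using that by (simp add: \<eta>_def \<phi>1)
    show "\<eta> k x = 0" if "\<bar>x\<bar> \<ge> real k + 1" for k x
    proof (cases "x \<ge> 0")
      case True
      with that show ?thesis by (simp add: \<eta>_def \<phi>0)
    next
      case False
      with that show ?thesis by (simp add: \<eta>_def \<phi>0)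
    qed
    show "norm (nth_deriv i (\<eta> k) x) \<le> 2 ^ j * (M j * M j)" if "i \<le> j" for i j k x
    proof -
      have bound: "norm (nth_deriv l (\<lambda>x. \<phi> (a * x + b)) x) \<le> M j" if "l \<le> i" "\<bar>a\<bar> = 1" for l a b
        using that \<open>i \<le> j\<close> by (simp add: nth_deriv_affine[OF sm] power_abs M)
      have "norm (nth_deriv i (\<eta> k) x) \<le> 2 ^ i * (M j * M j)"
        unfolding \<eta>_def
      proof (rule norm_nth_deriv_mult_le)
        show "norm (nth_deriv l (\<lambda>x. \<phi> (1 * x + (real k + 1))) x) \<le> M j"
          "norm (nth_deriv l (\<lambda>x. \<phi> (- 1 * x + (real k + 1))) x) \<le> M j" if "l \<le> i" for l
          by (rule bound[OF that], simp)+
      qed (rule smooth_fun_affine[OF sm])+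
      also have "\<dots> \<le> 2 ^ j * (M j * M j)"
        using that by (intro mult_right_mono power_increasing) auto
      finally show ?thesis .
    qed
  qed
qed

text \<open>The two functions agree where \<open>\<bar>x\<bar> < real k\<close>. Elsewhere both have
  size at most a constant times \<open>(1 + x\<^sup>2) ^ n\<close>, with the constant independent of
  \<open>k\<close>, and the additional weight factor is at least \<open>k\<close>; hence the
  exponent \<open>n + 1\<close>.\<close>

lemma strongly_close_cutoff:
  assumes g: "g \<in> O_M" and sm: "\<And>k. smooth_fun (\<eta> k)"
    and \<eta>1: "\<And>k x. \<bar>x\<bar> \<le> real k \<Longrightarrow> \<eta> k x = 1"
    and K: "\<And>k j i x. i \<le> j \<Longrightarrow> norm (nth_deriv i (\<eta> k) x) \<le> K j"
  shows "strongly_close (\<lambda>k x. \<eta> k x * g x) (\<lambda>_. g)"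
  unfolding strongly_close_def
proof
  fix j
  obtain n C where C: "\<And>i x. i \<le> j \<Longrightarrow> norm (nth_deriv i g x) \<le> C * (1 + x\<^sup>2) ^ n"
    using O_M_uniform_bound[OF g, of j] by auto
  have sg: "smooth_fun g"
    using g by (simp add: O_M_iff)
  define D where "D = 2 ^ j * (K j * C) + C"
  have "\<forall>\<^sub>F k in sequentially. \<forall>x.
      norm (nth_deriv j (\<lambda>x. \<eta> k x * g x) x - nth_deriv j g x) \<le> e * (1 + x\<^sup>2) ^ (n + 1)" if e: "e > 0" for e
    using eventually_ge_at_top[of "nat \<lceil>D / e\<rceil>"]
  proof eventually_elim
    case (elim k)
    then have "D / e \<le> real k"
      by linarith
    then have De: "D \<le> e * real k"
      using e by (simp add: field_simps)
    show ?case
    proof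
      fix x :: real
      show "norm (nth_deriv j (\<lambda>x. \<eta> k x * g x) x - nth_deriv j g x) \<le> e * (1 + x\<^sup>2) ^ (n + 1)"
      proof (cases "\<bar>x\<bar> < real k")
        case True
        then have "nth_deriv j (\<lambda>x. \<eta> k x * g x) x = nth_deriv j g x"
          by (intro nth_deriv_local[of "{- real k<..<real k}"]) (auto simp: \<eta>1)
        then show ?thesis using e by simp
      next
        case False
        moreover have "0 \<le> (\<bar>x\<bar> - 1)\<^sup>2"
          by simp
        then have "2 * \<bar>x\<bar> \<le> 1 + x\<^sup>2"
          by (simp add: power2_diff)
        ultimately have "real k \<le> 1 + x\<^sup>2"
          by linarith
        with De e have D: "D \<le> e * (1 + x\<^sup>2)"
          by (meson mult_left_mono order_less_imp_le order_trans)
        have "norm (nth_deriv j (\<lambda>x. \<eta> k x * g x) x) \<le> 2 ^ j * (K j * (C * (1 + x\<^sup>2) ^ n))"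
          by (rule norm_nth_deriv_mult_le[OF sm sg K C])
        then have "norm (nth_deriv j (\<lambda>x. \<eta> k x * g x) x - nth_deriv j g x) \<le> D * (1 + x\<^sup>2) ^ n"
          using norm_triangle_ineq4[of "nth_deriv j (\<lambda>x. \<eta> k x * g x) x" "nth_deriv j g x"] C[of j x]
          by (simp add: D_def algebra_simps)
        also have "\<dots> \<le> (e * (1 + x\<^sup>2)) * (1 + x\<^sup>2) ^ n"
          using D by (rule mult_right_mono) simp
        finally show ?thesis by (simp add: mult.assoc)
      qed
    qed
  qed
  then show "\<exists>n. \<forall>e>0. \<forall>\<^sub>F k in sequentially. \<forall>x.
      norm (nth_deriv j (\<lambda>x. \<eta> k x * g x) x - nth_deriv j g x) \<le> e * (1 + x\<^sup>2) ^ n"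
    by blast
qed

text \<open>A function is encoded by a mesh size and approximate values of its derivatives at the mesh
  points, taken from a countable dense set. Functions with a common code are uniformly close, so one
  representative for each of the countably many codes suffices.\<close>

lemma countable_uniformly_dense_subset:
  fixes S :: "(real \<Rightarrow> complex) set" and R m :: nat and \<epsilon> :: real
  assumes S: "\<And>f. f \<in> S \<Longrightarrow> smooth_fun f" and \<epsilon>: "\<epsilon> > 0"
  obtains A where "A \<subseteq> S" "countable A"
    "\<And>f. f \<in> S \<Longrightarrow> \<exists>a\<in>A. \<forall>j\<le>m. \<forall>x\<in>{- real R..real R}. norm (nth_deriv j a x - nth_deriv j f x) \<le> \<epsilon>"
proof -
  obtain D :: "complex set" where D: "countable D" "\<And>X. open X \<Longrightarrow> X \<noteq> {} \<Longrightarrow> \<exists>d\<in>D. d \<in> X"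
    using countable_dense_exists by metis
  define I where "I N = {..m} \<times> {- int (N * R)..int (N * R)}" for N
  define codes where "codes = (SIGMA N:UNIV. PiE (I N) (\<lambda>_. D))"
  \<comment> \<open>A code constrains \<open>f\<close> on whole neighbourhoods of the mesh points,
    not only at them. Thus a representative with the same code is controlled at every point,
    whatever its own modulus of continuity.\<close>
  define Q where "Q f = (\<lambda>(N, c). N > 0 \<and> (\<forall>(j, i)\<in>I N. \<forall>x\<in>{- real R..real R}.
      \<bar>x - of_int i / real N\<bar> \<le> 1 / real N \<longrightarrow> norm (nth_deriv j f x - c (j, i)) \<le> \<epsilon> / 2))" for f
  \<comment> \<open>Choosing the representative inside \<open>S\<close>, instead of interpolating
    the code, keeps the approximants smooth and supported as \<open>S\<close> prescribes.\<close>
  define pick where "pick c = (SOME f. f \<in> S \<and> Q f c)" for c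
  define A where "A = pick ` {c \<in> codes. \<exists>f\<in>S. Q f c}"
  have pick: "pick c \<in> S \<and> Q (pick c) c" if "f \<in> S" "Q f c" for f c
    unfolding pick_def by (rule someI[of _ f]) (use that in blast)
  have "countable codes"
    unfolding codes_def by (intro countable_SIGMA countable_PiE D) (auto simp: I_def)
  have code: "\<exists>c\<in>codes. Q f c" if "f \<in> S" for f
  proof -
    have "\<forall>\<^sub>F N in sequentially. \<forall>x\<in>{- real R..real R}. \<forall>y\<in>{- real R..real R}.
        \<bar>x - y\<bar> \<le> 1 / real N \<longrightarrow> norm (nth_deriv j f x - nth_deriv j f y) < \<epsilon> / 4" for j
    proof -
      have "uniformly_continuous_on {- real R..real R} (nth_deriv j f)"
        by (intro compact_uniformly_continuous smooth_fun_continuous_on S that) auto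
      then obtain d where d: "d > 0" "\<And>x y. x \<in> {- real R..real R} \<Longrightarrow> y \<in> {- real R..real R} \<Longrightarrow>
          dist x y < d \<Longrightarrow> dist (nth_deriv j f x) (nth_deriv j f y) < \<epsilon> / 4"
        unfolding uniformly_continuous_on_def using \<epsilon> by (metis divide_pos_pos zero_less_numeral)
      have "\<forall>\<^sub>F N in sequentially. 1 / real N < d"
        using order_tendstoD(2)[OF lim_1_over_n d(1)] by simp
      then show ?thesis
        by eventually_elim (use d(2) in \<open>auto simp: dist_norm\<close>)
    qed
    then have "\<forall>\<^sub>F N in sequentially. \<forall>j\<in>{..m}. \<forall>x\<in>{- real R..real R}. \<forall>y\<in>{- real R..real R}.
        \<bar>x - y\<bar> \<le> 1 / real N \<longrightarrow> norm (nth_deriv j f x - nth_deriv j f y) < \<epsilon> / 4"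
      by (simp add: eventually_ball_finite)
    from eventually_happens'[OF sequentially_bot eventually_conj[OF this eventually_gt_at_top[of 0]]]
    obtain N where N: "N > 0" "\<And>j x y. j \<le> m \<Longrightarrow> x \<in> {- real R..real R} \<Longrightarrow> y \<in> {- real R..real R} \<Longrightarrow>
        \<bar>x - y\<bar> \<le> 1 / real N \<Longrightarrow> norm (nth_deriv j f x - nth_deriv j f y) < \<epsilon> / 4"
      by auto
    have "\<exists>d\<in>D. d \<in> ball (nth_deriv j f (of_int i / real N)) (\<epsilon> / 4)" for j and i :: int
      using \<epsilon> by (intro D(2)) auto
    then obtain c where c: "\<And>j i. c j i \<in> D" "\<And>j i. dist (nth_deriv j f (of_int i / real N)) (c j i) < \<epsilon> / 4"
      unfolding mem_ball by metis
    \<comment> \<open>\<open>PiE\<close> admits only functions that are \<open>undefined\<close>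
      outside the finite index set; this is what keeps the set of codes countable.\<close>
    define c' where "c' = restrict (\<lambda>(j, i). c j i) (I N)"
    have "norm (nth_deriv j f x - c' (j, i)) \<le> \<epsilon> / 2"
      if "(j, i) \<in> I N" "x \<in> {- real R..real R}" "\<bar>x - of_int i / real N\<bar> \<le> 1 / real N" for j i x
    proof -
      have "\<bar>i\<bar> \<le> int (N * R)"
        using that(1) by (auto simp: I_def)
      then have "\<bar>real_of_int i\<bar> \<le> real N * real R"
        by (metis of_int_abs of_int_le_iff of_int_of_nat_eq of_nat_mult)
      then have "of_int i / real N \<in> {- real R..real R}"
        using N(1) by (auto simp: field_simps abs_le_iff)
      then have "norm (nth_deriv j f x - nth_deriv j f (of_int i / real N)) < \<epsilon> / 4"
        using that by (intro N(2)) (auto simp: I_def)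
      moreover have "norm (nth_deriv j f (of_int i / real N) - c' (j, i)) < \<epsilon> / 4"
        using c(2)[of j i] that(1) by (simp add: c'_def dist_norm)
      ultimately show ?thesis
        using norm_diff_triangle_less by fastforce
    qed
    then have "Q f (N, c')"
      using N(1) by (auto simp: Q_def)
    moreover have "(N, c') \<in> codes"
      using c(1) by (auto simp: codes_def c'_def)
    ultimately show ?thesis by blast
  qed
  show thesis
  proof
    show "A \<subseteq> S"
      using pick by (auto simp: A_def)
    show "countable A"
      unfolding A_def using \<open>countable codes\<close> by (intro countable_image) (auto intro: countable_subset)
    fix f assume f: "f \<in> S"
    obtain N c where c: "(N, c) \<in> codes" "Q f (N, c)"
      using code[OF f] by auto
    let ?a = "pick (N, c)"
    have Qa: "Q ?a (N, c)"
      using pick[OF f c(2)] by simp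
    have "norm (nth_deriv j ?a x - nth_deriv j f x) \<le> \<epsilon>" if "j \<le> m" "x \<in> {- real R..real R}" for j x
    proof -
      have N: "N > 0"
        using c(2) by (simp add: Q_def)
      \<comment> \<open>The floor yields a mesh point within 1/N of \<open>x\<close>; it stays in
        range since \<open>- R\<close> and \<open>R\<close> are themselves mesh points.\<close>
      define i where "i = \<lfloor>real N * x\<rfloor>"
      have "real N * x \<le> real N * real R" "real N * (- real R) \<le> real N * x"
        using that(2) by (intro mult_left_mono; simp)+
      then have "- int (N * R) \<le> i" "i \<le> int (N * R)"
        unfolding i_def by (simp_all add: le_floor_iff floor_le_iff)
      then have i: "(j, i) \<in> I N"
        using that(1) by (simp add: I_def)
      have "\<bar>real N * x - of_int i\<bar> \<le> 1"
        unfolding i_def by linarith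
      then have "\<bar>x - of_int i / real N\<bar> \<le> 1 / real N"
        using N by (simp add: field_simps abs_le_iff)
      then have "norm (nth_deriv j ?a x - c (j, i)) \<le> \<epsilon> / 2" "norm (nth_deriv j f x - c (j, i)) \<le> \<epsilon> / 2"
        using Qa c(2) i that(2) unfolding Q_def by auto
      then show ?thesis
        using norm_triangle_ineq4[of "nth_deriv j ?a x - c (j, i)" "nth_deriv j f x - c (j, i)"] by simp
    qed
    moreover have "?a \<in> A"
      using c f by (auto simp: A_def)
    ultimately show "\<exists>a\<in>A. \<forall>j\<le>m. \<forall>x\<in>{- real R..real R}. norm (nth_deriv j a x - nth_deriv j f x) \<le> \<epsilon>"
      by blast
  qed
qed

lemma nth_deriv_outside_support:
  assumes "\<And>x. \<bar>x\<bar> > r \<Longrightarrow> f x = 0" "\<bar>x\<bar> > r"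
  shows "nth_deriv j f x = 0"
proof -
  have "nth_deriv j f x = nth_deriv j (\<lambda>x. 0) x"
    by (rule nth_deriv_local[of "{x. r < \<bar>x\<bar>}"])
      (use assms in \<open>auto intro!: open_Collect_less continuous_intros\<close>)
  then show ?thesis by simp
qed

text \<open>At stage \<open>k\<close> the order, the radius and the accuracy improve together, so
  every fixed order and tolerance is met eventually. Members of \<open>S k\<close> vanish outside
  the stage interval, so closeness there is closeness on the whole line, with weight exponent 0; the
  truncation is what costs a polynomial weight.\<close>

lemma dense_sequence_exists:
  "\<exists>h :: nat \<Rightarrow> real \<Rightarrow> complex. (\<forall>i. smooth_fun (h i) \<and> (\<exists>r. \<forall>x. \<bar>x\<bar> > r \<longrightarrow> h i x = 0)) \<and>
    (\<forall>g\<in>O_M. \<exists>\<iota>. strongly_close (\<lambda>k. h (\<iota> k)) (\<lambda>_. g))"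
proof -
  obtain \<eta> K where sm: "\<And>k. smooth_fun (\<eta> k)" and \<eta>1: "\<And>k x. \<bar>x\<bar> \<le> real k \<Longrightarrow> \<eta> k x = 1"
    and \<eta>0: "\<And>k x. \<bar>x\<bar> \<ge> real k + 1 \<Longrightarrow> \<eta> k x = 0"
    and K: "\<And>k j i x. i \<le> j \<Longrightarrow> norm (nth_deriv i (\<eta> k) x) \<le> K j"
    using cutoff_exists by blast
  define S where "S k = {f. smooth_fun f \<and> (\<forall>x. \<bar>x\<bar> > real (Suc k) \<longrightarrow> f x = 0)}" for k
  have "\<exists>A. A \<subseteq> S k \<and> countable A \<and> (\<forall>f\<in>S k. \<exists>a\<in>A. \<forall>j\<le>k. \<forall>x\<in>{- real (Suc k)..real (Suc k)}.
      norm (nth_deriv j a x - nth_deriv j f x) \<le> 1 / real (Suc k))" for k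
  proof -
    obtain A where "A \<subseteq> S k" "countable A"
      "\<And>f. f \<in> S k \<Longrightarrow> \<exists>a\<in>A. \<forall>j\<le>k. \<forall>x\<in>{- real (Suc k)..real (Suc k)}.
        norm (nth_deriv j a x - nth_deriv j f x) \<le> 1 / real (Suc k)"
      by (rule countable_uniformly_dense_subset[of "S k" "1 / real (Suc k)" k "Suc k"]) (auto simp: S_def)
    then show ?thesis by blast
  qed
  then obtain A where A: "\<And>k. A k \<subseteq> S k" "\<And>k. countable (A k)"
    "\<And>k f. f \<in> S k \<Longrightarrow> \<exists>a\<in>A k. \<forall>j\<le>k. \<forall>x\<in>{- real (Suc k)..real (Suc k)}.
      norm (nth_deriv j a x - nth_deriv j f x) \<le> 1 / real (Suc k)"
    by metis
  define U where "U = (\<Union>k. A k)"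
  have U: "countable U"
    unfolding U_def using A(2) by blast
  \<comment> \<open>\<open>from_nat_into\<close> enumerates a set only if it is nonempty.\<close>
  have "(\<lambda>x. 0) \<in> S 0"
    by (simp add: S_def smooth_fun_const)
  from A(3)[OF this] obtain a where "a \<in> A 0" by (rule bexE)
  then have "U \<noteq> {}"
    by (auto simp: U_def)
  define h where "h = from_nat_into U"
  have h: "smooth_fun (h i) \<and> (\<exists>r. \<forall>x. \<bar>x\<bar> > r \<longrightarrow> h i x = 0)" for i
  proof -
    have "h i \<in> U"
      unfolding h_def using \<open>U \<noteq> {}\<close> by (rule from_nat_into)
    then obtain k where "h i \<in> A k"
      by (auto simp: U_def)
    then have "h i \<in> S k"
      using A(1) by (rule subsetD[rotated])
    then show ?thesis
      unfolding S_def by blast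
  qed
  have "\<exists>\<iota>. strongly_close (\<lambda>k. h (\<iota> k)) (\<lambda>_. g)" if g: "g \<in> O_M" for g
  proof -
    have G: "(\<lambda>x. \<eta> k x * g x) \<in> S k" for k
      using g \<eta>0 by (auto simp: S_def O_M_iff intro!: smooth_fun_mult sm)
    obtain a where a: "\<And>k. a k \<in> A k" "\<And>k j x. j \<le> k \<Longrightarrow> x \<in> {- real (Suc k)..real (Suc k)} \<Longrightarrow>
        norm (nth_deriv j (a k) x - nth_deriv j (\<lambda>x. \<eta> k x * g x) x) \<le> 1 / real (Suc k)"
      using A(3)[OF G] by metis
    have "strongly_close a (\<lambda>k x. \<eta> k x * g x)"
      unfolding strongly_close_def
    proof (intro allI exI impI)
      fix j and e :: real assume e: "e > 0"
      have "\<forall>\<^sub>F k in sequentially. 1 / real (Suc k) < e"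
        using order_tendstoD(2)[OF LIMSEQ_inverse_real_of_nat e] by (simp add: inverse_eq_divide)
      then show "\<forall>\<^sub>F k in sequentially. \<forall>x.
          norm (nth_deriv j (a k) x - nth_deriv j (\<lambda>x. \<eta> k x * g x) x) \<le> e * (1 + x\<^sup>2) ^ 0"
        using eventually_ge_at_top[of j]
      proof eventually_elim
        case (elim k)
        show ?case
        proof
          fix x
          show "norm (nth_deriv j (a k) x - nth_deriv j (\<lambda>x. \<eta> k x * g x) x) \<le> e * (1 + x\<^sup>2) ^ 0"
          proof (cases "\<bar>x\<bar> \<le> real (Suc k)")
            case True
            then have "x \<in> {- real (Suc k)..real (Suc k)}"
              by (simp add: abs_le_iff)
            from a(2)[OF elim(2) this] elim(1) show ?thesis by simp
          next
            case False
            moreover have "a k \<in> S k"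
              using a(1) A(1) by blast
            ultimately have "nth_deriv j (a k) x = 0" "nth_deriv j (\<lambda>x. \<eta> k x * g x) x = 0"
              using G[of k] by (auto simp: S_def intro!: nth_deriv_outside_support[of "real (Suc k)"])
            then show ?thesis using e by simp
          qed
        qed
      qed
    qed
    then have "strongly_close a (\<lambda>_. g)"
      by (rule strongly_close_trans) (rule strongly_close_cutoff[OF g sm \<eta>1 K])
    moreover have "h (to_nat_on U (a k)) = a k" for k
      unfolding h_def by (rule from_nat_into_to_nat_on[OF U]) (use a(1)[of k] in \<open>auto simp: U_def\<close>)
    ultimately show ?thesis
      by (intro exI[of _ "\<lambda>k. to_nat_on U (a k)"]) simp
  qed
  with h show ?thesis
    by (intro exI[of _ h]) simp
qed

section \<open>Superpositions of separated bumps\<close>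

text \<open>The extra 1 in the separation leaves a margin of 1/2 around each support, where the
  superposition is a single bump on an open set. The index type is left open: naturals serve the
  universal function, integers the periodic ones.\<close>

locale separated_bumps =
  fixes b r :: "'i \<Rightarrow> real" and g :: "'i \<Rightarrow> real \<Rightarrow> complex"
  assumes smooth: "\<And>i. smooth_fun (g i)"
    and support: "\<And>i x. \<bar>x\<bar> > r i \<Longrightarrow> g i x = 0"
    and separated: "\<And>i k. i \<noteq> k \<Longrightarrow> r i + r k + 1 \<le> \<bar>b i - b k\<bar>"
begin

text \<open>By separation at most one index contributes at each point, so the sum is finite and
  raises no question of convergence.\<close>

definition superposition :: "real \<Rightarrow> complex" where
  "superposition x = (\<Sum>i | \<bar>x - b i\<bar> \<le> r i. g i (x - b i))"

lemma superposition_near: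
  assumes "\<bar>x - b i\<bar> < r i + 1 / 2"
  shows "superposition x = g i (x - b i)"
proof -
  have sub: "{k. \<bar>x - b k\<bar> \<le> r k} \<subseteq> {i}"
  proof (clarify, rule ccontr)
    fix k assume "\<bar>x - b k\<bar> \<le> r k" "k \<notin> {}" "k \<noteq> i"
    with separated[of k i] assms show False
      by linarith
  qed
  show ?thesis
  proof (cases "\<bar>x - b i\<bar> \<le> r i")
    case True
    with sub have "{k. \<bar>x - b k\<bar> \<le> r k} = {i}" by auto
    then show ?thesis by (simp add: superposition_def)
  next
    case False
    with sub have "{k. \<bar>x - b k\<bar> \<le> r k} = {}" by auto
    moreover have "g i (x - b i) = 0"
      using False by (intro support) simp
    ultimately show ?thesis by (simp add: superposition_def)
  qed
qed

lemma superposition_far: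
  assumes "\<And>i. \<bar>x - b i\<bar> \<ge> r i + 1 / 2" "y \<in> ball x (1 / 2)"
  shows "superposition y = 0"
proof -
  have "\<not> \<bar>y - b i\<bar> \<le> r i" for i
    using assms(1)[of i] assms(2) unfolding mem_ball dist_real_def by linarith
  then show ?thesis by (simp add: superposition_def)
qed

lemma open_near: "open {x. \<bar>x - b i\<bar> < r i + 1 / 2}"
  by (intro open_Collect_less continuous_intros)

lemma nth_deriv_superposition_near:
  assumes "\<bar>x - b i\<bar> < r i + 1 / 2"
  shows "nth_deriv j superposition x = nth_deriv j (g i) (x - b i)"
proof -
  have "nth_deriv j superposition x = nth_deriv j (\<lambda>x. g i (x + - b i)) x"
    by (rule nth_deriv_local[OF open_near[of i]]) (use assms superposition_near in auto)
  then show ?thesis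
    unfolding nth_deriv_shift by simp
qed

lemma nth_deriv_superposition_off:
  assumes "\<And>i. \<bar>x - b i\<bar> > r i"
  shows "nth_deriv j superposition x = 0"
proof (cases "\<exists>i. \<bar>x - b i\<bar> < r i + 1 / 2")
  case True
  then show ?thesis
    using nth_deriv_superposition_near nth_deriv_outside_support[where r = "r i" for i, OF support assms] by auto
next
  case False
  then have "\<And>i. \<bar>x - b i\<bar> \<ge> r i + 1 / 2"
    by (meson not_less)
  from superposition_far[OF this]
  have "nth_deriv j superposition x = nth_deriv j (\<lambda>x. 0) x"
    by (intro nth_deriv_local[of "ball x (1 / 2)"]) auto
  then show ?thesis by simp
qed

lemma smooth_superposition: "smooth_fun superposition"
proof (rule smooth_fun_local)
  fix x
  show "\<exists>S g. open S \<and> x \<in> S \<and> smooth_fun g \<and> (\<forall>y\<in>S. superposition y = g y)"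
  proof (cases "\<exists>i. \<bar>x - b i\<bar> < r i + 1 / 2")
    case True
    then obtain i where i: "\<bar>x - b i\<bar> < r i + 1 / 2" ..
    show ?thesis
    proof (intro exI conjI)
      show "open {x. \<bar>x - b i\<bar> < r i + 1 / 2}" by (rule open_near)
      show "smooth_fun (\<lambda>x. g i (x + - b i))" by (rule smooth_fun_shift[OF smooth])
      show "\<forall>y\<in>{x. \<bar>x - b i\<bar> < r i + 1 / 2}. superposition y = g i (y + - b i)"
        using superposition_near by auto
    qed (use i in auto)
  next
    case False
    then have far: "\<And>i. \<bar>x - b i\<bar> \<ge> r i + 1 / 2"
      by (meson not_less)
    show ?thesis
    proof (intro exI conjI)
      show "open (ball x (1 / 2))" "x \<in> ball x (1 / 2)" by auto
      show "smooth_fun (\<lambda>x. 0)" by (rule smooth_fun_const)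
      show "\<forall>y\<in>ball x (1 / 2). superposition y = 0"
        using superposition_far[OF far] by blast
    qed
  qed
qed

text \<open>Seen from the centre \<open>b k\<close>, either the bump \<open>g k\<close> is visible,
  or \<open>x\<close> lies in a foreign bump and \<open>\<bar>x\<bar>\<close> is at least the
  distance to that bump. Points outside all supports fall under the first alternative, both sides
  being 0.\<close>

lemma translate_superposition_cases:
  obtains "nth_deriv j superposition (x + b k) = nth_deriv j (g k) x"
  | i where "i \<noteq> k" "\<bar>b i - b k\<bar> - r i \<le> \<bar>x\<bar>" "nth_deriv j (g k) x = 0"
      "nth_deriv j superposition (x + b k) = nth_deriv j (g i) (x + b k - b i)"
proof (cases "\<exists>i. \<bar>x + b k - b i\<bar> \<le> r i")
  case True
  then obtain i where i: "\<bar>x + b k - b i\<bar> \<le> r i" ..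
  then have eq: "nth_deriv j superposition (x + b k) = nth_deriv j (g i) (x + b k - b i)"
    by (intro nth_deriv_superposition_near) simp
  show thesis
  proof (cases "i = k")
    case True
    with eq that(1) show thesis by simp
  next
    case False
    have far: "\<bar>b i - b k\<bar> - r i \<le> \<bar>x\<bar>"
      using i by linarith
    then have "\<bar>x\<bar> > r k"
      using separated[OF False] by linarith
    then have "nth_deriv j (g k) x = 0"
      by (intro nth_deriv_outside_support[where r = "r k"] support)
    with that(2) False far eq show thesis by blast
  qed
next
  case False
  then have off: "\<And>i. \<bar>x + b k - b i\<bar> > r i"
    by (meson not_less)
  have "nth_deriv j superposition (x + b k) = 0"
    by (rule nth_deriv_superposition_off[OF off])
  moreover have "nth_deriv j (g k) x = 0"
    by (rule nth_deriv_outside_support[where r = "r k", OF support]) (use off[of k] in auto)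
  ultimately show thesis
    using that(1) by simp
qed

end

section \<open>Compactly supported functions and subsequences\<close>

lemma nth_deriv_bounded_of_support:
  assumes "smooth_fun f" "\<And>x. \<bar>x\<bar> > r \<Longrightarrow> f x = 0"
  shows "\<exists>B\<ge>0. \<forall>x. norm (nth_deriv j f x) \<le> B"
proof -
  obtain B where B: "\<And>x. x \<in> {- r..r} \<Longrightarrow> norm (nth_deriv j f x) \<le> B"
    using smooth_fun_bounded_on_compact[OF assms(1), of "{- r..r}" j] by auto
  have "norm (nth_deriv j f x) \<le> max B 0" for x
  proof (cases "\<bar>x\<bar> > r")
    case True
    then show ?thesis
      by (simp add: nth_deriv_outside_support[where r = r, OF assms(2)])
  next
    case False
    then have "x \<in> {- r..r}"
      by auto
    from B[OF this] show ?thesis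
      by (simp add: le_max_iff_disj)
  qed
  then show ?thesis
    by (intro exI[of _ "max B 0"]) auto
qed

lemma compact_support_in_O_M:
  assumes "smooth_fun f" "\<And>x. \<bar>x\<bar> > r \<Longrightarrow> f x = 0"
  shows "f \<in> O_M"
  unfolding O_M_iff
proof (intro conjI allI)
  fix j
  obtain B where "\<forall>x. norm (nth_deriv j f x) \<le> B"
    using nth_deriv_bounded_of_support[where r = r, OF assms] by blast
  then show "\<exists>n C. \<forall>x. norm (nth_deriv j f x) \<le> C * (1 + x\<^sup>2) ^ n"
    by (intro exI[of _ 0] exI[of _ B]) simp
qed (rule assms)

lemma strongly_close_subseq:
  assumes "strongly_close s t" "filterlim \<kappa> at_top sequentially"
  shows "strongly_close (\<lambda>k. s (\<kappa> k)) (\<lambda>k. t (\<kappa> k))"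
  unfolding strongly_close_def
proof
  fix j
  obtain n where n: "\<forall>e>0. \<forall>\<^sub>F k in sequentially. \<forall>x.
     norm (nth_deriv j (s k) x - nth_deriv j (t k) x) \<le> e * (1 + x\<^sup>2) ^ n"
    using strongly_closeD[OF assms(1), of j] ..
  show "\<exists>n. \<forall>e>0. \<forall>\<^sub>F k in sequentially. \<forall>x.
     norm (nth_deriv j (s (\<kappa> k)) x - nth_deriv j (t (\<kappa> k)) x) \<le> e * (1 + x\<^sup>2) ^ n"
  proof (intro exI[of _ n] allI impI)
    fix e :: real assume "e > 0"
    then have "\<forall>\<^sub>F k in sequentially. \<forall>x.
        norm (nth_deriv j (s k) x - nth_deriv j (t k) x) \<le> e * (1 + x\<^sup>2) ^ n"
      using n by blast
    from eventually_compose_filterlim[OF this assms(2)]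
    show "\<forall>\<^sub>F k in sequentially. \<forall>x.
        norm (nth_deriv j (s (\<kappa> k)) x - nth_deriv j (t (\<kappa> k)) x) \<le> e * (1 + x\<^sup>2) ^ n" .
  qed
qed

section \<open>A universal function and periodic approximation\<close>

text \<open>The bumps \<open>g k\<close> run through the dense sequence \<open>h\<close>, each term infinitely often. The centres
  \<open>b k\<close> outgrow the sizes of all earlier bumps, so that seen from \<open>b k\<close> every other bump is
  dominated by a linear function of the distance.\<close>

lemma universal_function_exists:
  fixes \<beta> :: real
  assumes "\<beta> \<noteq> 0"
  shows "\<exists>F\<in>O_M. \<forall>y\<in>O_M. \<exists>N::nat \<Rightarrow> nat. filterlim N at_top sequentially \<and>
    strongly_close (\<lambda>k x. F (x + real (N k) * \<beta>)) (\<lambda>_. y)"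
proof -
  obtain h :: "nat \<Rightarrow> real \<Rightarrow> complex" where
    h: "(\<forall>i. smooth_fun (h i) \<and> (\<exists>r. \<forall>x. \<bar>x\<bar> > r \<longrightarrow> h i x = 0)) \<and>
      (\<forall>g\<in>O_M. \<exists>\<iota>. strongly_close (\<lambda>k. h (\<iota> k)) (\<lambda>_. g))"
    using dense_sequence_exists ..
  then have smh: "\<And>i. smooth_fun (h i)" and "\<forall>i. \<exists>r. \<forall>x. \<bar>x\<bar> > r \<longrightarrow> h i x = 0"
    by simp_all
  from this(2) obtain \<rho> where "\<forall>i. \<forall>x. \<bar>x\<bar> > \<rho> i \<longrightarrow> h i x = 0"
    unfolding choice_iff ..
  then have \<rho>: "\<And>i x. \<bar>x\<bar> > \<rho> i \<Longrightarrow> h i x = 0"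
    by simp
  define g where "g k = h (fst (prod_decode k))" for k
  define r where "r k = \<bar>\<rho> (fst (prod_decode k))\<bar>" for k
  have smg: "smooth_fun (g k)" for k
    by (simp add: g_def smh)
  have supp: "g k x = 0" if "\<bar>x\<bar> > r k" for k x
    using that unfolding g_def r_def by (intro \<rho>) linarith
  have r_nonneg: "r k \<ge> 0" for k
    by (simp add: r_def)
  have "\<forall>k j. \<exists>B. B \<ge> 0 \<and> (\<forall>x. norm (nth_deriv j (g k) x) \<le> B)"
    by (intro allI nth_deriv_bounded_of_support[OF smg supp])
  then obtain B where "\<forall>k j. B k j \<ge> 0 \<and> (\<forall>x. norm (nth_deriv j (g k) x) \<le> B k j)"
    unfolding choice_iff ..
  then have B_nonneg: "\<And>k j. B k j \<ge> 0" and B: "\<And>k j x. norm (nth_deriv j (g k) x) \<le> B k j"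
    by simp_all
  \<comment> \<open>One centre cannot dominate all derivatives of its bump, so bump \<open>k\<close>
    is controlled by its centre only up to order \<open>k\<close>. For a fixed order
    \<open>j\<close> the finitely many bumps \<open>i < j\<close> go into the constant
    \<open>C j\<close> below.\<close>
  define M where "M k = (\<Sum>j\<le>k. B k j)" for k
  have M_nonneg: "M k \<ge> 0" for k
    by (simp add: M_def sum_nonneg B_nonneg)
  define Q where "Q k = 1 + (\<Sum>i\<le>k. r i + M i)" for k
  have Q_mono: "Q i \<le> Q k" if "i \<le> k" for i k
    unfolding Q_def using that r_nonneg M_nonneg by (intro add_left_mono sum_mono2) auto
  have Q_ge1: "Q k \<ge> 1" for k
    unfolding Q_def using r_nonneg M_nonneg by (simp add: sum_nonneg)
  have Q_M: "M k \<le> Q k" for k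
    unfolding Q_def using r_nonneg M_nonneg member_le_sum[of k "{..k}" "\<lambda>i. r i + M i"]
    by (smt (verit) atMost_iff finite_atMost order_refl)
  have Q_r: "r i + r k + 1 \<le> Q k" if "i < k" for i k
  proof -
    have "(\<Sum>i\<in>{i, k}. r i + M i) \<le> (\<Sum>i\<le>k. r i + M i)"
      using that r_nonneg M_nonneg by (intro sum_mono2) auto
    then show ?thesis
      using that M_nonneg[of i] M_nonneg[of k] by (simp add: Q_def)
  qed
  define c where "c k = nat \<lceil>Q k / \<bar>\<beta>\<bar>\<rceil>" for k
  have c_mono: "c i \<le> c k" if "i \<le> k" for i k
    unfolding c_def using Q_mono[OF that] by (intro nat_mono ceiling_mono divide_right_mono) auto
  have c_Q: "Q k \<le> real (c k) * \<bar>\<beta>\<bar>" for k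
  proof -
    have "Q k / \<bar>\<beta>\<bar> \<le> real (c k)"
      unfolding c_def by linarith
    then show ?thesis using assms by (simp add: field_simps)
  qed
  have c_pos: "c k \<ge> 1" for k
    using c_Q[of k] Q_ge1[of k] by (cases "c k") auto
  \<comment> \<open>\<open>c k\<close> rounds \<open>Q k\<close> up to a multiple of
    \<open>\<bar>\<beta>\<bar>\<close>. The power makes the centres grow at least by a factor 4, and
    the 8 makes each centre dominate the radii of its own and all earlier bumps with room to
    spare.\<close>
  define N where "N k = 8 * 4 ^ k * c k" for k :: nat
  define b where "b k = real (N k) * \<beta>" for k
  have abs_b: "\<bar>b k\<bar> = real (N k) * \<bar>\<beta>\<bar>" for k
    by (simp add: b_def abs_mult)
  have k_less: "k \<le> 4 ^ k" for k :: nat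
    by (rule less_imp_le[OF order.strict_trans2[OF less_exp]]) (simp add: power_mono)
  have N_ge: "k \<le> N k" for k
    unfolding N_def using mult_le_mono[OF k_less[of k] c_pos[of k]] by simp
  have b_ge: "8 * 4 ^ k * Q k \<le> \<bar>b k\<bar>" for k
    unfolding abs_b N_def using mult_left_mono[OF c_Q[of k], of "8 * 4 ^ k"] by (simp add: mult.assoc)
  have b_Q: "8 * Q k \<le> \<bar>b k\<bar>" for k
  proof -
    have "8 * 1 * Q k \<le> 8 * 4 ^ k * Q k"
      using Q_ge1[of k] by (intro mult_right_mono mult_left_mono) auto
    with b_ge[of k] show ?thesis by simp
  qed
  have b_k: "8 * real k \<le> \<bar>b k\<bar>" for k
  proof -
    have "real k \<le> 4 ^ k"
      using k_less[of k] by (metis of_nat_le_iff of_nat_numeral of_nat_power)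
    then have "8 * real k * 1 \<le> 8 * 4 ^ k * Q k"
      using Q_ge1[of k] by (intro mult_mono) auto
    with b_ge[of k] show ?thesis by simp
  qed
  have b_growth: "4 * \<bar>b i\<bar> \<le> \<bar>b k\<bar>" if "i < k" for i k
  proof -
    have "(4::nat) ^ Suc i \<le> 4 ^ k"
      using that by (intro power_increasing) auto
    then have "4 * N i \<le> N k"
      unfolding N_def using mult_le_mono[of "4 ^ Suc i" "4 ^ k" "c i" "c k"] c_mono[of i k] that
      by (simp add: mult_ac)
    then have "real (4 * N i) * \<bar>\<beta>\<bar> \<le> real (N k) * \<bar>\<beta>\<bar>"
      by (intro mult_right_mono) auto
    then show ?thesis by (simp add: abs_b)
  qed
  have gap_less: "r i + r k + 1 \<le> \<bar>b i - b k\<bar> \<and> \<bar>b k\<bar> / 2 + (r i + r k) \<le> \<bar>b i - b k\<bar> \<and> \<bar>b i\<bar> \<le> \<bar>b k\<bar>"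
    if "i < k" for i k
  proof -
    \<comment> \<open>The distance \<open>d\<close> is at least 3/4 of the larger centre
      \<open>Y\<close>, while the radii \<open>R\<close> use at most 1/8 of it; more than half of
      \<open>Y\<close> remains.\<close>
    have arith: "R + 1 \<le> d \<and> Y / 2 + R \<le> d \<and> X \<le> Y"
      if "4 * X \<le> Y" "8 * q \<le> Y" "R + 1 \<le> q" "Y - X \<le> d" "0 \<le> X" "0 \<le> R" for d q R X Y :: real
      using that by linarith
    show ?thesis
    proof (rule arith)
      show "\<bar>b k\<bar> - \<bar>b i\<bar> \<le> \<bar>b i - b k\<bar>" by linarith
    qed (use b_growth[OF that] b_Q[of k] Q_r[OF that] r_nonneg in auto)
  qed
  \<comment> \<open>The first bound is the separation. The second limits the foreign centre, hence
    the size of its bump, by \<open>2 * \<bar>x\<bar>\<close>; the third shows that foreign bumps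
    move off to infinity with \<open>k\<close>.\<close>
  have gap: "r i + r k + 1 \<le> \<bar>b i - b k\<bar>" "\<bar>b i\<bar> / 2 \<le> \<bar>b i - b k\<bar> - r i" "\<bar>b k\<bar> / 2 \<le> \<bar>b i - b k\<bar> - r i"
    if "i \<noteq> k" for i k
  proof -
    have "r i + r k + 1 \<le> \<bar>b i - b k\<bar> \<and> \<bar>b i\<bar> / 2 \<le> \<bar>b i - b k\<bar> - r i \<and> \<bar>b k\<bar> / 2 \<le> \<bar>b i - b k\<bar> - r i"
    proof (cases "i < k")
      case True
      with gap_less[OF True] r_nonneg[of k] show ?thesis
        by (elim conjE, intro conjI) linarith+
    next
      case False
      then have "k < i" using that by simp
      from gap_less[OF this] r_nonneg[of k] show ?thesis
        unfolding abs_minus_commute[of "b i" "b k"] by (elim conjE, intro conjI) linarith+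
    qed
    then show "r i + r k + 1 \<le> \<bar>b i - b k\<bar>" "\<bar>b i\<bar> / 2 \<le> \<bar>b i - b k\<bar> - r i" "\<bar>b k\<bar> / 2 \<le> \<bar>b i - b k\<bar> - r i"
      by simp_all
  qed
  interpret separated_bumps b r g
    by unfold_locales (use smg supp gap in auto)
  define C where "C j = (\<Sum>i<j. B i j)" for j
  have C_nonneg: "C j \<ge> 0" for j
    by (simp add: C_def sum_nonneg B_nonneg)
  have bump_bound: "norm (nth_deriv j (g i) x) \<le> C j + \<bar>b i\<bar>" for i j x
  proof (cases "j \<le> i")
    case True
    then have "B i j \<le> M i"
      unfolding M_def using B_nonneg by (intro member_le_sum) auto
    also have "\<dots> \<le> \<bar>b i\<bar>"
      using Q_M[of i] b_Q[of i] Q_ge1[of i] by linarith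
    finally show ?thesis
      using B[of j i x] C_nonneg[of j] by linarith
  next
    case False
    then have "B i j \<le> C j"
      unfolding C_def using B_nonneg by (intro member_le_sum) auto
    then show ?thesis
      using B[of j i x] by linarith
  qed
  have translate: "nth_deriv j superposition (x + b k) = nth_deriv j (g k) x \<or>
      nth_deriv j (g k) x = 0 \<and> \<bar>b k\<bar> / 2 \<le> \<bar>x\<bar> \<and>
      norm (nth_deriv j superposition (x + b k)) \<le> C j + 2 * \<bar>x\<bar>" for j k x
  proof (cases rule: translate_superposition_cases[of j x k])
    case (2 i)
    note gap' = order_trans[OF gap(2)[OF 2(1)] 2(2)] order_trans[OF gap(3)[OF 2(1)] 2(2)]
    have "norm (nth_deriv j superposition (x + b k)) \<le> C j + \<bar>b i\<bar>"
      unfolding 2(4) by (rule bump_bound)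
    also have "\<dots> \<le> C j + 2 * \<bar>x\<bar>"
      using gap'(1) by simp
    finally show ?thesis
      using 2(3) gap'(2) by blast
  qed simp
  \<comment> \<open>The estimates hold as seen from a centre, and 0 is not one. So the translate by
    \<open>b 0\<close> is shown to be in the space and is then shifted back.\<close>
  have "(\<lambda>x. superposition (x + b 0)) \<in> O_M"
    unfolding O_M_iff nth_deriv_shift
  proof (intro conjI allI exI)
    show "smooth_fun (\<lambda>x. superposition (x + b 0))"
      by (rule smooth_fun_shift[OF smooth_superposition])
    show "norm (nth_deriv j superposition (x + b 0)) \<le> (B 0 j + C j + 2) * (1 + x\<^sup>2) ^ 1" for j x
    proof -
      have "0 \<le> (\<bar>x\<bar> - 1)\<^sup>2"
        by simp
      then have x: "2 * \<bar>x\<bar> \<le> 1 + x\<^sup>2"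
        by (simp add: power2_diff)
      have "(B 0 j + C j) * 1 \<le> (B 0 j + C j) * (1 + x\<^sup>2)"
        using B_nonneg C_nonneg by (intro mult_left_mono) auto
      then have "B 0 j + C j + 2 * \<bar>x\<bar> \<le> (B 0 j + C j + 2) * (1 + x\<^sup>2) ^ 1"
        using x by (simp add: algebra_simps)
      moreover have "norm (nth_deriv j superposition (x + b 0)) \<le> B 0 j + C j + 2 * \<bar>x\<bar>"
        using translate[of j x 0] B[of j 0 x] B_nonneg[of 0 j] C_nonneg[of j] by auto
      ultimately show ?thesis by linarith
    qed
  qed
  from O_M_shift[OF this, of "- b 0"] have F: "superposition \<in> O_M"
    by simp
  have close: "strongly_close (\<lambda>k x. superposition (x + b k)) g"
    unfolding strongly_close_def nth_deriv_shift
  proof (intro allI exI impI)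
    fix j and e :: real assume e: "e > 0"
    show "\<forall>\<^sub>F k in sequentially. \<forall>x.
        norm (nth_deriv j superposition (x + b k) - nth_deriv j (g k) x) \<le> e * (1 + x\<^sup>2) ^ 1"
      \<comment> \<open>Foreign bumps occur only at \<open>\<bar>x\<bar> \<ge> 4 * real k\<close>,
        where the linear bound with constant \<open>C j + 2\<close> lies below e times the square of
        \<open>x\<close>. The added 1 forces \<open>\<bar>x\<bar> \<ge> 1\<close>, used to absorb
        \<open>C j\<close>.\<close>
      using eventually_ge_at_top[of "nat \<lceil>(C j + 2) / e\<rceil> + 1"]
    proof eventually_elim
      case (elim k)
      then have k: "k \<ge> 1" "(C j + 2) / e \<le> real k"
        by linarith+
      show ?case
      proof
        fix x
        show "norm (nth_deriv j superposition (x + b k) - nth_deriv j (g k) x) \<le> e * (1 + x\<^sup>2) ^ 1"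
          using translate[of j x k]
        proof (elim disjE conjE)
          assume *: "nth_deriv j (g k) x = 0" "\<bar>b k\<bar> / 2 \<le> \<bar>x\<bar>"
            "norm (nth_deriv j superposition (x + b k)) \<le> C j + 2 * \<bar>x\<bar>"
          then have x: "1 \<le> \<bar>x\<bar>" "(C j + 2) / e \<le> \<bar>x\<bar>"
            using k b_k[of k] by linarith+
          have "C j * 1 \<le> C j * \<bar>x\<bar>"
            using x(1) C_nonneg by (intro mult_left_mono) auto
          then have "C j + 2 * \<bar>x\<bar> \<le> (C j + 2) * \<bar>x\<bar>"
            by (simp add: algebra_simps)
          also have "\<dots> \<le> (e * \<bar>x\<bar>) * \<bar>x\<bar>"
            using x(2) e by (intro mult_right_mono) (auto simp: field_simps)
          also have "\<dots> \<le> e * (1 + x\<^sup>2) ^ 1"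
            using e by (simp add: power2_eq_square algebra_simps)
          finally show ?thesis using * by simp
        qed (use e in simp)
      qed
    qed
  qed
  show ?thesis
  proof (intro bexI[OF _ F] ballI)
    fix y assume "y \<in> O_M"
    with h have "\<exists>\<iota>. strongly_close (\<lambda>k. h (\<iota> k)) (\<lambda>_. y)"
      by simp
    then obtain \<iota> where \<iota>: "strongly_close (\<lambda>k. h (\<iota> k)) (\<lambda>_. y)" ..
    \<comment> \<open>The first component makes \<open>g (\<kappa> k)\<close> equal to
      \<open>h (\<iota> k)\<close>; the second forces \<open>\<kappa>\<close> to infinity even if
      \<open>\<iota>\<close> is bounded.\<close>
    define \<kappa> where "\<kappa> k = prod_encode (\<iota> k, k)" for k
    have "k \<le> \<kappa> k" for k
      unfolding \<kappa>_def by (rule le_prod_encode_2)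
    then have \<kappa>: "filterlim \<kappa> at_top sequentially"
      by (intro filterlim_at_top_mono[OF filterlim_ident]) auto
    have "filterlim N at_top sequentially"
      using N_ge by (intro filterlim_at_top_mono[OF filterlim_ident]) auto
    then have "filterlim (\<lambda>k. N (\<kappa> k)) at_top sequentially"
      using \<kappa> by (rule filterlim_compose)
    moreover have "strongly_close (\<lambda>k x. superposition (x + b (\<kappa> k))) (\<lambda>k. g (\<kappa> k))"
      by (rule strongly_close_subseq[OF close \<kappa>])
    then have "strongly_close (\<lambda>k x. superposition (x + b (\<kappa> k))) (\<lambda>_. y)"
      by (rule strongly_close_trans) (use \<iota> in \<open>simp add: g_def \<kappa>_def\<close>)
    ultimately show "\<exists>N::nat \<Rightarrow> nat. filterlim N at_top sequentially \<and>
        strongly_close (\<lambda>k x. superposition (x + real (N k) * \<beta>)) (\<lambda>_. y)"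
      by (intro exI[of _ "\<lambda>k. N (\<kappa> k)"]) (simp add: b_def)
  qed
qed

text \<open>All bumps are copies of the same \<open>h\<close>, so each derivative of
  \<open>s k\<close> is bounded independently of \<open>k\<close>, and \<open>s k\<close> differs
  from \<open>h\<close> only far out. The weight \<open>1 + x\<^sup>2\<close> turns this into
  convergence.\<close>

lemma periodic_approximation:
  fixes \<beta> :: real
  assumes \<beta>: "\<beta> \<noteq> 0" and h: "smooth_fun h" "\<And>x. \<bar>x\<bar> > r \<Longrightarrow> h x = 0"
  shows "\<exists>s. (\<forall>k. s k \<in> O_M \<and> (\<exists>p\<ge>1. \<forall>x. s k (x + real p * \<beta>) = s k x)) \<and> strongly_close s (\<lambda>_. h)"
proof -
  have "\<forall>j. \<exists>B. B \<ge> 0 \<and> (\<forall>x. norm (nth_deriv j h x) \<le> B)"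
    by (intro allI nth_deriv_bounded_of_support[OF h])
  then obtain B where "\<forall>j. B j \<ge> 0 \<and> (\<forall>x. norm (nth_deriv j h x) \<le> B j)"
    unfolding choice_iff ..
  then have B: "\<And>j x. norm (nth_deriv j h x) \<le> B j"
    by simp
  \<comment> \<open>Twice the radius plus 1 is the separation the locale asks for; the summand
    \<open>real k\<close> drives the neighbouring copies away from the origin.\<close>
  define p where "p k = nat \<lceil>(2 * \<bar>r\<bar> + 1 + real k) / \<bar>\<beta>\<bar>\<rceil>" for k :: nat
  have p: "2 * \<bar>r\<bar> + 1 + real k \<le> real (p k) * \<bar>\<beta>\<bar>" for k
  proof -
    have "(2 * \<bar>r\<bar> + 1 + real k) / \<bar>\<beta>\<bar> \<le> real (p k)"
      unfolding p_def by linarith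
    then show ?thesis using \<beta> by (simp add: field_simps)
  qed
  define b where "b k i = real_of_int i * (real (p k) * \<beta>)" for k i
  have gap: "2 * \<bar>r\<bar> + 1 + real k \<le> \<bar>b k i - b k i'\<bar>" if "i \<noteq> i'" for k i i'
  proof -
    have "1 \<le> \<bar>real_of_int (i - i')\<bar>"
      using that by linarith
    then have "1 * (real (p k) * \<bar>\<beta>\<bar>) \<le> \<bar>real_of_int (i - i')\<bar> * (real (p k) * \<bar>\<beta>\<bar>)"
      by (rule mult_right_mono) auto
    also have "\<dots> = \<bar>b k i - b k i'\<bar>"
      by (simp add: b_def abs_mult flip: left_diff_distrib)
    finally show ?thesis using p[of k] by simp
  qed
  have bumps: "separated_bumps (b k) (\<lambda>_. r) (\<lambda>_. h)" for k
  proof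
    show "r + r + 1 \<le> \<bar>b k i - b k i'\<bar>" if "i \<noteq> i'" for i i'
      using gap[OF that, of k] by linarith
  qed (use h in auto)
  define s where "s k = separated_bumps.superposition (b k) (\<lambda>_. r) (\<lambda>_. h)" for k
  have translate: "nth_deriv j (s k) x = nth_deriv j h x \<or>
      1 + real k \<le> \<bar>x\<bar> \<and> nth_deriv j h x = 0 \<and> norm (nth_deriv j (s k) x) \<le> B j" for j k x
  proof -
    interpret separated_bumps "b k" "\<lambda>_. r" "\<lambda>_. h" by (rule bumps)
    have [simp]: "b k 0 = 0" by (simp add: b_def)
    show ?thesis
    proof (cases rule: translate_superposition_cases[of j x 0])
      case (2 i)
      then have "1 + real k \<le> \<bar>x\<bar>"
        using gap[of i 0 k] by linarith
      with 2 B show ?thesis by (simp add: s_def)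
    qed (simp add: s_def)
  qed
  show ?thesis
  proof (intro exI[of _ s] conjI allI)
    show "s k \<in> O_M" for k
      unfolding O_M_iff
    proof (intro conjI allI exI)
      show "smooth_fun (s k)"
        unfolding s_def by (rule separated_bumps.smooth_superposition[OF bumps])
      show "norm (nth_deriv j (s k) x) \<le> B j * (1 + x\<^sup>2) ^ 0" for j x
        using translate[of j k x] B[of j x] by auto
    qed
    have "s k (x + real (p k) * \<beta>) = s k x" for k x
    proof -
      let ?I = "\<lambda>x. {i. \<bar>x - b k i\<bar> \<le> r}"
      \<comment> \<open>A shift by one period lowers the index by one; indexing by all integers
        makes this a bijection of the index sets.\<close>
      have shift: "x + real (p k) * \<beta> - b k i = x - b k (i - 1)" for i
        by (simp add: b_def algebra_simps)
      have "(\<Sum>i\<in>?I (x + real (p k) * \<beta>). h (x + real (p k) * \<beta> - b k i)) = (\<Sum>i\<in>?I x. h (x - b k i))"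
        by (rule sum.reindex_bij_witness[where i = "\<lambda>i. i + 1" and j = "\<lambda>i. i - 1"])
          (simp_all add: shift)
      then show ?thesis
        by (simp add: s_def separated_bumps.superposition_def[OF bumps])
    qed
    moreover have "p k \<ge> 1" for k
      using p[of k] by (cases "p k") auto
    ultimately show "\<exists>p\<ge>1. \<forall>x. s k (x + real p * \<beta>) = s k x" for k
      by (intro exI[of _ "p k"]) simp
    show "strongly_close s (\<lambda>_. h)"
      unfolding strongly_close_def
    proof (intro allI exI impI)
      fix j and e :: real assume e: "e > 0"
      show "\<forall>\<^sub>F k in sequentially. \<forall>x.
          norm (nth_deriv j (s k) x - nth_deriv j h x) \<le> e * (1 + x\<^sup>2) ^ 1"
        using eventually_ge_at_top[of "nat \<lceil>B j / e\<rceil>"]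
      proof eventually_elim
        case (elim k)
        then have k: "B j / e \<le> real k"
          by linarith
        show ?case
        proof
          fix x
          show "norm (nth_deriv j (s k) x - nth_deriv j h x) \<le> e * (1 + x\<^sup>2) ^ 1"
            using translate[of j k x]
          proof (elim disjE conjE)
            assume *: "1 + real k \<le> \<bar>x\<bar>" "nth_deriv j h x = 0" "norm (nth_deriv j (s k) x) \<le> B j"
            have "0 \<le> (\<bar>x\<bar> - 1)\<^sup>2"
              by simp
            then have "2 * \<bar>x\<bar> \<le> 1 + x\<^sup>2"
              by (simp add: power2_diff)
            with k * have "B j / e \<le> 1 + x\<^sup>2"
              by linarith
            with e have "B j \<le> e * (1 + x\<^sup>2) ^ 1"
              by (simp add: field_simps)
            with * show ?thesis by simp
          qed (use e in simp)
        qed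
      qed
    qed
  qed
qed

section \<open>Dynamics of the translation operator\<close>

lemma funpow_composition_shift:
  assumes "\<And>x. \<psi> x = x + \<beta>"
  shows "(composition_operator \<psi> ^^ n) f = (\<lambda>x. f (x + real n * \<beta>))"
  by (induction n) (auto simp: composition_operator_def assms algebra_simps)

theorem corollary6:
  fixes \<beta> :: real and \<psi> :: "real \<Rightarrow> real"
  assumes "\<beta> \<noteq> 0"
    and "\<And>x. \<psi> x = x + \<beta>"
  shows "continuous_linear_operator OM_topology (composition_operator \<psi>) \<and>
         sequentially_hypercyclic OM_topology (composition_operator \<psi>) \<and>
         chaotic OM_topology (composition_operator \<psi>)"
proof -
  let ?T = "composition_operator \<psi>"
  note T_pow = funpow_composition_shift[where \<psi> = \<psi> and \<beta> = \<beta>, OF assms(2)]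
  have "?T = (\<lambda>f x. f (x + \<beta>))"
    by (intro ext) (simp add: composition_operator_def assms(2))
  then have "continuous_linear_operator OM_topology ?T"
    using continuous_map_shift by (simp add: continuous_linear_operator_def)
  moreover
  obtain F where F: "F \<in> O_M"
    and universal: "\<forall>y\<in>O_M. \<exists>N::nat \<Rightarrow> nat. filterlim N at_top sequentially \<and>
        strongly_close (\<lambda>k x. F (x + real (N k) * \<beta>)) (\<lambda>_. y)"
    using universal_function_exists[OF assms(1)] ..
  have orbit: "\<exists>N::nat \<Rightarrow> nat. filterlim N at_top sequentially \<and>
      limitin OM_topology (\<lambda>k. (?T ^^ N k) F) y sequentially" if y: "y \<in> O_M" for y
  proof -
    obtain N :: "nat \<Rightarrow> nat" where N: "filterlim N at_top sequentially"
      "strongly_close (\<lambda>k x. F (x + real (N k) * \<beta>)) (\<lambda>_. y)"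
      using bspec[OF universal y] by auto
    have "limitin OM_topology (\<lambda>k x. F (x + real (N k) * \<beta>)) y sequentially"
      by (rule strongly_close_imp_limitin[OF O_M_shift[OF F] y N(2)])
    with N(1) show ?thesis
      by (auto simp: T_pow)
  qed
  have "sequentially_hypercyclic OM_topology ?T"
    unfolding sequentially_hypercyclic_def
  proof (intro bexI[of _ F] ballI)
    fix y assume "y \<in> topspace OM_topology"
    then obtain N :: "nat \<Rightarrow> nat" where "limitin OM_topology (\<lambda>k. (?T ^^ N k) F) y sequentially"
      using orbit by auto
    then show "\<exists>s. range s \<subseteq> {(?T ^^ n) F |n. True} \<and> limitin OM_topology s y sequentially"
      by (intro exI[of _ "\<lambda>k. (?T ^^ N k) F"]) auto
  qed (simp add: F)
  moreover have "topologically_transitive OM_topology ?T"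
    unfolding topologically_transitive_def
  proof (intro allI impI, elim conjE)
    fix U V assume U: "openin OM_topology U" "U \<noteq> {}" and V: "openin OM_topology V" "V \<noteq> {}"
    \<comment> \<open>Arbitrarily late visits are essential: a visit to \<open>V\<close> after one
      to \<open>U\<close> makes the exponent \<open>q - p\<close> at least 1.\<close>
    have visits: "\<exists>n\<ge>m. (?T ^^ n) F \<in> W" if W: "openin OM_topology W" "W \<noteq> {}" for W m
    proof -
      obtain w where w: "w \<in> W" using W(2) by blast
      then have "w \<in> O_M"
        using openin_subset[OF W(1)] by auto
      then obtain N :: "nat \<Rightarrow> nat" where N: "filterlim N at_top sequentially"
        "limitin OM_topology (\<lambda>k. (?T ^^ N k) F) w sequentially"
        using orbit by blast
      have "\<forall>\<^sub>F k in sequentially. (?T ^^ N k) F \<in> W"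
        using N(2) W(1) w by (simp add: limitin_def)
      moreover have "\<forall>\<^sub>F k in sequentially. m \<le> N k"
        using N(1) by (simp add: filterlim_at_top)
      ultimately have "\<forall>\<^sub>F k in sequentially. (?T ^^ N k) F \<in> W \<and> m \<le> N k"
        by (rule eventually_conj)
      then show ?thesis
        using eventually_happens'[OF sequentially_bot] by blast
    qed
    obtain p where p: "(?T ^^ p) F \<in> U"
      using visits[OF U] by blast
    obtain q where q: "q \<ge> p + 1" "(?T ^^ q) F \<in> V"
      using visits[OF V] by blast
    have "(?T ^^ (q - p)) ((?T ^^ p) F) = (?T ^^ q) F"
      using q(1) by (simp flip: funpow_add[unfolded o_def, THEN fun_cong])
    with p q show "\<exists>n\<ge>1. (?T ^^ n) ` U \<inter> V \<noteq> {}"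
      by (intro exI[of _ "q - p"]) (auto intro: image_eqI)
  qed
  moreover have "OM_topology closure_of periodic_points OM_topology ?T = topspace OM_topology"
  proof (intro equalityI subsetI)
    let ?P = "periodic_points OM_topology ?T"
    fix g assume "g \<in> topspace OM_topology"
    then have g: "g \<in> O_M" by simp
    obtain h :: "nat \<Rightarrow> real \<Rightarrow> complex" where
      h: "(\<forall>i. smooth_fun (h i) \<and> (\<exists>r. \<forall>x. \<bar>x\<bar> > r \<longrightarrow> h i x = 0)) \<and>
        (\<forall>g\<in>O_M. \<exists>\<iota>. strongly_close (\<lambda>k. h (\<iota> k)) (\<lambda>_. g))"
      using dense_sequence_exists ..
    have supp: "\<exists>r. smooth_fun (h i) \<and> (\<forall>x. \<bar>x\<bar> > r \<longrightarrow> h i x = 0)" for i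
      using h by simp
    have h_O_M: "h i \<in> O_M" for i
      using supp[of i] compact_support_in_O_M[of "h i"] by auto
    \<comment> \<open>Closedness of the closure lets the two limits, periodic functions to
      \<open>h i\<close> and then the \<open>h i\<close> to \<open>g\<close>, be taken one after the
      other without a diagonal sequence.\<close>
    have h_closure: "h i \<in> OM_topology closure_of ?P" for i
    proof -
      obtain r where r: "smooth_fun (h i) \<and> (\<forall>x. \<bar>x\<bar> > r \<longrightarrow> h i x = 0)"
        using supp[of i] ..
      have "\<exists>s. (\<forall>k. s k \<in> O_M \<and> (\<exists>p\<ge>1. \<forall>x. s k (x + real p * \<beta>) = s k x)) \<and> strongly_close s (\<lambda>_. h i)"
        by (rule periodic_approximation[of _ _ r]) (use assms(1) r in auto)
      then obtain s where s: "(\<forall>k. s k \<in> O_M \<and> (\<exists>p\<ge>1. \<forall>x. s k (x + real p * \<beta>) = s k x)) \<and>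
          strongly_close s (\<lambda>_. h i)" ..
      then have "limitin OM_topology s (h i) sequentially"
        by (intro strongly_close_imp_limitin h_O_M) auto
      moreover have "s k \<in> ?P" for k
        unfolding periodic_points_def using s by (simp add: T_pow fun_eq_iff)
      moreover have "?P \<subseteq> OM_topology closure_of ?P"
        by (rule closure_of_subset) (auto simp: periodic_points_def)
      ultimately show ?thesis
        by (intro limitin_closedin[OF _ closedin_closure_of]) (auto intro: always_eventually)
    qed
    have "\<exists>\<iota>. strongly_close (\<lambda>k. h (\<iota> k)) (\<lambda>_. g)"
      using h g by simp
    then obtain \<iota> where "strongly_close (\<lambda>k. h (\<iota> k)) (\<lambda>_. g)" ..
    then have "limitin OM_topology (\<lambda>k. h (\<iota> k)) g sequentially"
      by (intro strongly_close_imp_limitin h_O_M g)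
    then show "g \<in> OM_topology closure_of ?P"
      by (rule limitin_closedin[OF _ closedin_closure_of]) (use h_closure in auto)
  qed (meson closure_of_subset_topspace subsetD)
  ultimately show ?thesis
    by (simp add: chaotic_def)
qed

end
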